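(* Let $L$ be a closed quipu on $n\ge 13$ vertices with spectral radius $\rho(L)<\frac{3}{2}\sqrt{2}$. Then the diameter of $L$ satisfies $\frac{n}{3}<D(L)\le \frac{2n-2}{3}$. Moreover, if $L$ is neither $C^{(m)}_{(2m+3)}$ nor $C^{(m)}_{(2m+5)}$ for any integer $m\ge 1$, then $D(L)\le \frac{2n-4}{3}$.
   Context: All graphs are finite and simple; the spectral radius $\rho(G)$ is the largest eigenvalue of the adjacency matrix, and $D(G)$ is the diameter. A pendant path of length $\ell\ge1$ attached at a vertex $v$ means $\ell$ new vertices $u_1,\dots,u_\ell$ and the path $vu_1\cdots u_\ell$. A closed quipu is a connected graph of maximum degree at most $3$ containing exactly one cycle, such that every vertex of degree $3$ lies on that cycle (i.e. a cycle with pendant paths attached at some of its vertices, at most one per vertex). For $r\ge1$, $k_i\ge 0$, $m_i\ge1$, $C_{(k_1,\dots,k_r)}^{(m_1,\dots,m_r)}$ denotes the closed quipu whose cycle contains vertices $v_1,\dots,v_r$ in cyclic order, consecutive ones being joined along the cycle by paths with $k_1,\dots,k_r$ internal vertices respectively, and with a pendant path of length $m_i$ attached at $v_i$. In particular $C^{(m)}_{(k)}$ is a cycle of length $k+1$ with one pendant path of length $m$ attached at one of its vertices. *)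

theory Defs
  imports "Graph_Theory.Graph_Theory" "Jordan_Normal_Form.Spectral_Radius"
begin

text \<open>
  Finite simple graphs are modelled by the locale \<open>pair_graph\<close>: finite, loop-free, symmetric
  digraphs whose arcs are pairs of vertices.
\<close>

text \<open>
  The rows and columns are indexed by an arbitrary enumeration of the vertices; the spectrum does
  not depend on its choice.
\<close>

definition adjacency_matrix :: "'a pair_pre_digraph \<Rightarrow> real mat" where
  "adjacency_matrix G =
    (let vs = (SOME vs. distinct vs \<and> set vs = pverts G)
     in mat (length vs) (length vs) (\<lambda>(i, j). if (vs ! i, vs ! j) \<in> parcs G then 1 else 0))"

definition graph_spectral_radius :: "'a pair_pre_digraph \<Rightarrow> real" where
  "graph_spectral_radius G = Max (spectrum (adjacency_matrix G))"

definition graph_dist :: "'a pair_pre_digraph \<Rightarrow> 'a \<Rightarrow> 'a \<Rightarrow> ereal" where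
  "graph_dist G u v = wf_digraph.\<mu> (with_proj G) (\<lambda>_. 1) u v"

definition graph_diameter :: "'a pair_pre_digraph \<Rightarrow> ereal" where
  "graph_diameter G = (SUP u \<in> pverts G. SUP v \<in> pverts G. graph_dist G u v)"

text \<open>
  The cycles of a graph, as sets of undirected edges, so that the starting point and the direction
  of traversal do not matter. The closed walks \<open>u, v, u\<close> along a single edge are cycles of
  the symmetric digraph and are excluded by the length condition.
\<close>

definition graph_cycles :: "'a pair_pre_digraph \<Rightarrow> 'a set set set" where
  "graph_cycles G =
    {(\<lambda>(u, v). {u, v}) ` set p | p. pre_digraph.cycle (with_proj G) p \<and> 3 \<le> length p}"

definition closed_quipu :: "'a pair_pre_digraph \<Rightarrow> bool" where
  "closed_quipu G \<longleftrightarrow>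
     pair_graph G \<and>
     Digraph_Component.connected (with_proj G) \<and>
     (\<forall>v \<in> pverts G. out_degree (with_proj G) v \<le> 3) \<and>
     (\<exists>!C. C \<in> graph_cycles G) \<and>
     (\<forall>C \<in> graph_cycles G. \<forall>v \<in> pverts G. out_degree (with_proj G) v = 3 \<longrightarrow> v \<in> \<Union>C)"

text \<open>
  The graph $C^{(m)}_{(k)}$ for $k \ge 2$: the cycle of length $k + 1$ runs through the
  vertices $0, \ldots, k$, and the pendant path $k + 1, \ldots, k + m$ is attached at the vertex $k$.
\<close>

definition quipu_one :: "nat \<Rightarrow> nat \<Rightarrow> nat pair_pre_digraph" where
  "quipu_one k m =
    (let E = {(i, i + 1) | i. i < k + m} \<union> {(0, k)}
     in \<lparr>pverts = {0..k + m}, parcs = E \<union> E\<inverse>\<rparr>)"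

end

theory Submission
  imports Defs "HOL-Analysis.Function_Topology"
begin

text \<open>
  Label a closed quipu by its cycle length \<open>g\<close> and the pendant lengths \<open>m 0, ..., m (g - 1)\<close>, some of
  them zero. A positive eigenfunction \<open>f\<close> satisfies \<open>A f < (x + 1/x) f\<close> with \<open>x = sqrt 2\<close>. A pendant
  path of length \<open>m\<close> forces a definite mass next to its root, and multiplying the resulting local
  inequalities for the ratios of \<open>f\<close> around the cycle gives
  \<open>(\<Prod>i<g. (2 ^ (m i + 2) - 3)\<^sup>2) < 2 ^ g\<close>. So the pendant paths have total length less than \<open>g / 2\<close>,
  and one or two of them already force \<open>g\<close> to be large. The diameter is at least \<open>m i + g div 2\<close> for
  every \<open>i\<close>, and at most the largest \<open>m i + m k + g div 2\<close> with \<open>i \<noteq> k\<close>, so both bounds become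
  arithmetic.
\<close>

section \<open>Positive eigenfunctions\<close>

text \<open>At \<open>x = sqrt 2\<close> the recurrence
  \<open>f (j - 1) + f (j + 1) = (x + 1/x) * f j\<close> has the solutions \<open>x ^ j\<close> and
  \<open>1 / x ^ j\<close>, whose quotient gains a factor 2 per edge; this is the origin of all
  powers of 2. An inequality at one vertex says little, since its two cycle neighbours can trade
  mass. Multiplying around the cycle removes this freedom: with the ratios recoded as odds, every
  edge contributes exactly 1/2, whatever the values of \<open>f\<close>.

  The factor \<open>2 ^ (a + 2) - 3\<close> is at least \<open>2 ^ a\<close>, which alone gives the
  bound on the total pendant length and the lower diameter bound. The upper bound needs the excess
  over \<open>2 ^ a\<close>, spent on one or two pendants at a time. What remains tight is a parity
  effect: for a single pendant of length \<open>a\<close> and \<open>g >= 2 * a + 4\<close>, the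
  inequality \<open>3 * (a + g div 2) + 4 <= 2 * (g + a)\<close> fails only at
  \<open>g = 2 * a + 4\<close> and \<open>g = 2 * a + 6\<close>. These are the two exceptional
  families, whose cycle lengths are \<open>k + 1\<close> for \<open>k = 2 * a + 3\<close> and
  \<open>k = 2 * a + 5\<close>.\<close>

lemma linear_coefficient_eq_zero:
  fixes a b :: real
  assumes "\<And>t. 2 * t * a + t\<^sup>2 * b \<le> 0"
  shows "a = 0"
proof (rule ccontr)
  assume a: "a \<noteq> 0"
  define c where "c = \<bar>b\<bar> + 1"
  have c: "c > 0" "b \<ge> - c" by (auto simp: c_def)
  have "2 * (a / c) * a + (a / c)\<^sup>2 * b \<ge> 2 * (a / c) * a - (a / c)\<^sup>2 * c"
    using mult_left_mono[OF c(2), of "(a / c)\<^sup>2"] by simp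
  also have "2 * (a / c) * a - (a / c)\<^sup>2 * c = a\<^sup>2 / c"
    using c by (simp add: field_simps power2_eq_square)
  finally have "2 * (a / c) * a + (a / c)\<^sup>2 * b > 0"
    using a c by (meson divide_pos_pos less_le_trans zero_less_power2)
  with assms[of "a / c"] show False by simp
qed

text \<open>Maximise the quadratic form \<open>Q\<close> on the unit sphere \<open>N x = 1\<close>.
  As \<open>A\<close> is nonnegative, passing to absolute values does not lower \<open>Q\<close>, so
  a nonnegative maximiser exists; its first-order condition in each coordinate direction is the
  eigenvalue equation.\<close>

lemma symmetric_nonneg_eigenfunction_exists:
  fixes A :: "'a \<Rightarrow> 'a \<Rightarrow> real"
  assumes fin: "finite V" and ne: "V \<noteq> {}"
    and sym: "\<And>v w. A v w = A w v" and nonneg: "\<And>v w. A v w \<ge> 0"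
  shows "\<exists>\<mu> f. (\<forall>v. f v \<ge> 0) \<and> (\<exists>v\<in>V. f v \<noteq> 0) \<and> (\<forall>v\<in>V. (\<Sum>w\<in>V. A v w * f w) = \<mu> * f v)"
proof -
  define Q where "Q x = (\<Sum>v\<in>V. \<Sum>w\<in>V. A v w * x v * x w)" for x :: "'a \<Rightarrow> real"
  define N where "N x = (\<Sum>v\<in>V. (x v)\<^sup>2)" for x :: "'a \<Rightarrow> real"
  \<comment> \<open>\<open>V\<close> is finite but the type need not be: forcing the value 0 off
    \<open>V\<close> makes this box a product of compact sets, hence compact in the product
    topology.\<close>
  define B where "B = (\<Pi>\<^sub>E v\<in>UNIV. if v \<in> V then {-1..1} else {0::real})"
  have coord: "continuous_on UNIV (\<lambda>x::'a \<Rightarrow> real. x v)" for v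
    by simp
  have contQ: "continuous_on UNIV Q" and contN: "continuous_on UNIV N"
    unfolding Q_def N_def by (intro continuous_intros coord)+
  have "compactin euclidean B"
    unfolding B_def euclidean_product_topology[symmetric] by (subst compactin_PiE) auto
  then have "compact B" by simp
  moreover have "closed {x. N x = 1}"
    using continuous_closed_preimage[OF contN closed_UNIV closed_singleton[of 1]]
    by (simp add: vimage_def)
  ultimately have cK: "compact (B \<inter> {x. N x = 1})" by (rule compact_Int_closed)
  obtain v0 where v0: "v0 \<in> V" using ne by auto
  have "(\<lambda>v. if v = v0 then 1 else 0) \<in> B \<inter> {x. N x = 1}"
    using v0 fin by (auto simp: B_def N_def PiE_def if_distrib[of "\<lambda>x. x\<^sup>2"] sum.delta cong: if_cong)
  then obtain z where z: "z \<in> B" "N z = 1" and zmax: "\<And>x. x \<in> B \<Longrightarrow> N x = 1 \<Longrightarrow> Q x \<le> Q z"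
    using continuous_attains_sup[OF cK _ continuous_on_subset[OF contQ]] by blast
  define \<mu> where "\<mu> = Q z"
  have N_nonneg: "N x \<ge> 0" for x unfolding N_def by (simp add: sum_nonneg)
  have bound: "Q x \<le> \<mu> * N x" for x
  proof (cases "N x = 0")
    case True
    then have "\<forall>v\<in>V. x v = 0" using fin by (simp add: N_def sum_nonneg_eq_0_iff)
    then have "Q x = 0" by (simp add: Q_def)
    with True show ?thesis by simp
  next
    case False
    define s where "s = sqrt (N x)"
    have s: "s > 0" "s\<^sup>2 = N x" using False N_nonneg[of x] by (auto simp: s_def)
    define y where "y v = (if v \<in> V then x v / s else 0)" for v
    have "(x v)\<^sup>2 \<le> N x" if "v \<in> V" for v
      unfolding N_def using that fin by (intro member_le_sum) auto
    then have "\<bar>x v\<bar> \<le> s" if "v \<in> V" for v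
      unfolding s_def using that by (metis real_sqrt_abs real_sqrt_le_mono)
    then have "\<bar>x v / s\<bar> \<le> 1" if "v \<in> V" for v
      using that s by (simp add: abs_divide)
    then have "-1 \<le> x v / s \<and> x v / s \<le> 1" if "v \<in> V" for v
      using that by (metis abs_le_iff minus_le_iff)
    then have "y \<in> B" unfolding B_def y_def by (auto simp: PiE_def)
    moreover have Ny: "N y = N x / s\<^sup>2"
      unfolding N_def y_def by (simp add: power_divide sum_divide_distrib)
    moreover have "Q y = Q x / s\<^sup>2"
      unfolding Q_def y_def by (simp add: sum_divide_distrib power2_eq_square)
    ultimately have "Q x / N x \<le> \<mu>"
      using zmax[of y] s False by (simp add: \<mu>_def)
    then show ?thesis
      using False N_nonneg[of x] by (simp add: pos_divide_le_eq mult.commute)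
  qed
  define f where "f v = \<bar>z v\<bar>" for v
  have Nf: "N f = 1" using z by (simp add: N_def f_def)
  have "Q z \<le> Q f" unfolding Q_def f_def
    by (intro sum_mono) (metis abs_ge_self abs_mult abs_of_nonneg nonneg)
  with bound[of f] Nf have Qf: "Q f = \<mu>" by (simp add: \<mu>_def)
  have "(\<Sum>w\<in>V. A v w * f w) = \<mu> * f v" if v: "v \<in> V" for v
  proof -
    define L where "L = (\<Sum>w\<in>V. A v w * f w)"
    have "2 * t * (L - \<mu> * f v) + t\<^sup>2 * (A v v - \<mu>) \<le> 0" for t
    proof -
      define e where "e w = (if w = v then 1 else 0::real)" for w
      have "N (\<lambda>w. f w + t * e w) = (\<Sum>w\<in>V. (f w)\<^sup>2 + 2 * t * (f w * e w) + t\<^sup>2 * (e w * e w))"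
        unfolding N_def by (intro sum.cong) (simp_all add: power2_eq_square algebra_simps)
      also have "\<dots> = N f + 2 * t * (\<Sum>w\<in>V. f w * e w) + t\<^sup>2 * (\<Sum>w\<in>V. e w * e w)"
        by (simp add: N_def sum.distrib sum_distrib_left)
      also have "\<dots> = 1 + 2 * t * f v + t\<^sup>2"
        using v fin Nf by (simp add: e_def sum.delta' if_distrib[of "\<lambda>x. _ * x"] cong: if_cong)
      finally have 1: "N (\<lambda>w. f w + t * e w) = 1 + 2 * t * f v + t\<^sup>2" .
      have "Q (\<lambda>w. f w + t * e w) = (\<Sum>u\<in>V. \<Sum>w\<in>V. A u w * f u * f w + t * (A u w * f w * e u)
          + t * (A u w * f u * e w) + t\<^sup>2 * (A u w * e u * e w))"
        unfolding Q_def by (intro sum.cong) (simp_all add: power2_eq_square algebra_simps)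
      also have "\<dots> = Q f + t * (\<Sum>u\<in>V. \<Sum>w\<in>V. A u w * f w * e u)
          + t * (\<Sum>u\<in>V. \<Sum>w\<in>V. A u w * f u * e w) + t\<^sup>2 * (\<Sum>u\<in>V. \<Sum>w\<in>V. A u w * e u * e w)"
        by (simp add: Q_def sum.distrib sum_distrib_left)
      also have "(\<Sum>u\<in>V. \<Sum>w\<in>V. A u w * f w * e u) = L"
        unfolding sum_distrib_right[symmetric] using v fin
        by (simp add: e_def L_def if_distrib[of "\<lambda>x. _ * x"] cong: if_cong)
      also have "(\<Sum>u\<in>V. \<Sum>w\<in>V. A u w * f u * e w) = (\<Sum>u\<in>V. A u v * f u)"
        using v fin by (simp add: e_def if_distrib[of "\<lambda>x. _ * x"] cong: if_cong)
      also have "\<dots> = L" unfolding L_def by (simp add: sym[of v])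
      also have "(\<Sum>u\<in>V. \<Sum>w\<in>V. A u w * e u * e w) = A v v"
        using v fin by (simp add: e_def if_distrib[of "\<lambda>x. _ * x"] cong: if_cong)
      finally have 2: "Q (\<lambda>w. f w + t * e w) = \<mu> + 2 * t * L + t\<^sup>2 * A v v"
        using Qf by simp
      show ?thesis using bound[of "\<lambda>w. f w + t * e w"] unfolding 1 2 by (simp add: algebra_simps)
    qed
    from linear_coefficient_eq_zero[OF this] show ?thesis by (simp add: L_def)
  qed
  moreover have "\<exists>v\<in>V. f v \<noteq> 0"
  proof (rule ccontr)
    assume "\<not> ?thesis"
    then have "N f = 0" by (simp add: N_def)
    with Nf show False by simp
  qed
  ultimately show ?thesis by (intro exI[of _ \<mu>] exI[of _ f]) (auto simp: f_def)
qed

lemma le_graph_spectral_radius: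
  fixes f :: "'a \<Rightarrow> real"
  assumes fin: "finite (pverts G)" and nz: "v0 \<in> pverts G" "f v0 \<noteq> 0"
    and eig: "\<And>v. v \<in> pverts G \<Longrightarrow> (\<Sum>w | w \<in> pverts G \<and> (v, w) \<in> parcs G. f w) = \<mu> * f v"
  shows "\<mu> \<le> graph_spectral_radius G"
proof -
  define vs where "vs = (SOME vs. distinct vs \<and> set vs = pverts G)"
  have vs: "distinct vs" "set vs = pverts G"
    using someI_ex[of "\<lambda>vs. distinct vs \<and> set vs = pverts G"] finite_distinct_list[OF fin]
    unfolding vs_def by blast+
  define n where "n = length vs"
  define A where "A = adjacency_matrix G"
  have A: "A = mat n n (\<lambda>(i, j). if (vs ! i, vs ! j) \<in> parcs G then 1 else 0)"
    unfolding A_def adjacency_matrix_def vs_def[symmetric] n_def by (simp add: Let_def)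
  then have Ac: "A \<in> carrier_mat n n" by simp
  define x where "x = vec n (\<lambda>i. f (vs ! i))"
  have sum_vs: "(\<Sum>j<n. h (vs ! j)) = (\<Sum>w\<in>pverts G. h w)" for h :: "'a \<Rightarrow> real"
  proof -
    have "(\<Sum>j<n. h (vs ! j)) = sum_list (map h vs)"
      by (simp add: sum_list_sum_nth n_def atLeast0LessThan)
    with vs show ?thesis by (simp add: sum_list_distinct_conv_sum_set)
  qed
  have "A *\<^sub>v x = \<mu> \<cdot>\<^sub>v x"
  proof (rule eq_vecI)
    fix i assume "i < dim_vec (\<mu> \<cdot>\<^sub>v x)"
    then have i: "i < n" by (simp add: x_def)
    then have vi: "vs ! i \<in> pverts G" using vs n_def nth_mem by metis
    have "(A *\<^sub>v x) $ i = (\<Sum>j<n. if (vs ! i, vs ! j) \<in> parcs G then f (vs ! j) else 0)"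
      using i unfolding A x_def
      by (auto simp: scalar_prod_def atLeast0LessThan intro!: sum.cong)
    also have "\<dots> = (\<Sum>w\<in>pverts G. if (vs ! i, w) \<in> parcs G then f w else 0)"
      by (rule sum_vs[of "\<lambda>w. if (vs ! i, w) \<in> parcs G then f w else 0"])
    also have "\<dots> = \<mu> * f (vs ! i)"
      using eig[OF vi] fin by (simp add: sum.inter_filter)
    finally show "(A *\<^sub>v x) $ i = (\<mu> \<cdot>\<^sub>v x) $ i" using i by (simp add: x_def)
  qed (auto simp: A x_def)
  moreover obtain i where "i < n" "vs ! i = v0"
    using nz vs by (metis in_set_conv_nth n_def)
  then have "x \<noteq> 0\<^sub>v n" using nz(2) unfolding x_def by (metis index_vec index_zero_vec(1))
  ultimately have "eigenvector A x \<mu>"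
    using Ac unfolding eigenvector_def by (auto simp: x_def)
  then have "\<mu> \<in> spectrum A" unfolding spectrum_def eigenvalue_def by auto
  then show ?thesis unfolding graph_spectral_radius_def A_def[symmetric]
    using card_finite_spectrum(1)[OF Ac] by (rule Max_ge[rotated])
qed

text \<open>A zero of a nonnegative eigenfunction spreads: the values at its neighbours sum to 0, so
  each is 0, and connectedness carries this to a vertex where \<open>f\<close> is nonzero.\<close>

lemma (in pair_graph) positive_eigenfunction_exists:
  assumes conn: "Digraph_Component.connected (with_proj G)"
  shows "\<exists>\<mu> f. \<mu> \<le> graph_spectral_radius G \<and> (\<forall>v\<in>pverts G. f v > 0) \<and>
    (\<forall>v\<in>pverts G. (\<Sum>w | w \<in> pverts G \<and> (v, w) \<in> parcs G. f w) = \<mu> * f v)"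
proof -
  have sc: "strongly_connected (with_proj G)"
    using symmetric_connected_imp_strongly_connected[OF pair_sym_arcs conn] .
  then have ne: "pverts G \<noteq> {}"
    and reach: "\<And>u v. u \<in> pverts G \<Longrightarrow> v \<in> pverts G \<Longrightarrow> u \<rightarrow>\<^sup>*\<^bsub>with_proj G\<^esub> v"
    by (auto simp: strongly_connected_def)
  define A where "A v w = (if (v, w) \<in> parcs G then 1 else 0::real)" for v w
  have "A v w = A w v" and "A v w \<ge> 0" for v w unfolding A_def using arcs_symmetric by auto
  from symmetric_nonneg_eigenfunction_exists[of _ A, OF pair_finite_verts ne this]
  obtain \<mu> f where f: "\<And>v. f v \<ge> 0" "\<exists>v\<in>pverts G. f v \<noteq> 0"
    and eig: "\<And>v. v \<in> pverts G \<Longrightarrow> (\<Sum>w\<in>pverts G. A v w * f w) = \<mu> * f v"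
    by blast
  have eig': "(\<Sum>w | w \<in> pverts G \<and> (v, w) \<in> parcs G. f w) = \<mu> * f v" if "v \<in> pverts G" for v
    using eig[OF that] pair_finite_verts by (simp add: A_def sum.inter_filter if_distrib[of "\<lambda>x. x * _"] cong: if_cong)
  obtain v0 where v0: "v0 \<in> pverts G" "f v0 \<noteq> 0" using f by auto
  have "f v > 0" if v: "v \<in> pverts G" for v
  proof (rule ccontr)
    assume "\<not> f v > 0"
    then have "f v = 0" using f(1)[of v] by linarith
    from reach[OF v v0(1)] have "f v0 = 0"
    proof (induct rule: reachable_induct)
      case base show ?case by fact
    next
      case (step x y)
      then have xy: "(x, y) \<in> parcs G" by simp
      then have "(\<Sum>w | w \<in> pverts G \<and> (x, w) \<in> parcs G. f w) = 0"
        using eig'[of x] step in_arcsD1 by simp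
      then show ?case using xy f(1) in_arcsD2[OF xy] pair_finite_verts
        by (auto simp: sum_nonneg_eq_0_iff)
    qed
    with v0 show False by simp
  qed
  moreover have "\<mu> \<le> graph_spectral_radius G"
    using le_graph_spectral_radius[OF pair_finite_verts v0(1)] v0(2) eig' by blast
  ultimately show ?thesis using eig' by blast
qed

section \<open>The ratios of a supersolution along paths and cycles\<close>

text \<open>
  With \<open>x = sqrt 2\<close> the bound is \<open>x + 1/x\<close>, and \<open>(x^m - x^-m) / (x^(m+1) - x^-(m+1))\<close> is the ratio
  of the solution of the recurrence that vanishes just beyond the end of the path.
\<close>

lemma pendant_path_ratio:
  fixes f :: "nat \<Rightarrow> real"
  assumes "m \<ge> 1"
    and "\<And>j. j \<le> m \<Longrightarrow> f j > 0"
    and "\<And>j. Suc j < m \<Longrightarrow> f j + f (Suc (Suc j)) < 3 / sqrt 2 * f (Suc j)"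
    and "f (m - 1) < 3 / sqrt 2 * f m"
  shows "sqrt 2 * (2 ^ m - 1) * f 0 < (2 ^ (m + 1) - 1) * f 1"
  using assms
proof (induction m arbitrary: f rule: nat_induct_at_least)
  case base
  then show ?case by (simp add: field_simps)
next
  case (Suc m)
  define q :: real where "q = 2 ^ m"
  have q: "q \<ge> 2" using Suc.hyps power_increasing[of 1 m "2::real"] by (simp add: q_def)
  \<comment> \<open>The induction removes the root, so the hypothesis is applied to the shifted
    function.\<close>
  have "sqrt 2 * (2 ^ m - 1) * f (Suc 0) < (2 ^ (m + 1) - 1) * f (Suc 1)"
  proof (rule Suc.IH[of "\<lambda>j. f (Suc j)"])
    show "f (Suc (m - 1)) < 3 / sqrt 2 * f (Suc m)" using Suc by simp
  qed (use Suc.prems in auto)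
  then have 1: "sqrt 2 * (q - 1) * f 1 < (2 * q - 1) * f 2"
    by (simp add: q_def numeral_2_eq_2)
  have "f 0 + f 2 < 3 / sqrt 2 * f 1" using Suc.prems(2)[of 0] Suc.hyps by (simp add: numeral_2_eq_2)
  from mult_strict_left_mono[OF this, of "sqrt 2"]
  have "sqrt 2 * (f 0 + f 2) < sqrt 2 * (3 / sqrt 2 * f 1)" by simp
  then have 2: "sqrt 2 * f 0 < 3 * f 1 - sqrt 2 * f 2" by (simp add: algebra_simps)
  have "sqrt 2 * (sqrt 2 * (q - 1) * f 1) < sqrt 2 * ((2 * q - 1) * f 2)" using 1 by simp
  then have 3: "2 * (q - 1) * f 1 < (2 * q - 1) * (sqrt 2 * f 2)"
    by (simp add: mult.assoc[symmetric] mult.left_commute) (simp add: mult_ac)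
  \<comment> \<open>The multiplier \<open>2 * q - 1\<close> lets the induction hypothesis eliminate
    \<open>f 2\<close>; the new coefficient is
    \<open>3 * (2 * q - 1) - 2 * (q - 1) = 4 * q - 1\<close>.\<close>
  have "(2 * q - 1) * (sqrt 2 * f 0) < (2 * q - 1) * (3 * f 1 - sqrt 2 * f 2)"
    using 2 q by simp
  also have "\<dots> < (2 * q - 1) * (3 * f 1) - 2 * (q - 1) * f 1"
    using 3 by (simp add: right_diff_distrib)
  also have "\<dots> = (4 * q - 1) * f 1" by (simp add: algebra_simps)
  finally show ?case by (simp add: q_def mult_ac)
qed

text \<open>The constant comes from the boundary case \<open>a = b = 1 / (2 * q)\<close>, where both
  odds are \<open>1 / (2 * q - 1)\<close>. Cleared of denominators, the claim is
  \<open>4 * a * b * q * (q - 1) < 1 - a - b\<close>, which follows from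
  \<open>4 * a * b <= (a + b)^2\<close> and two uses of \<open>(a + b) * q < 1\<close>.\<close>

lemma odds_product_less:
  fixes a b q :: real
  assumes ab: "0 < a" "a < 1" "0 < b" "b < 1" and q: "q \<ge> 1" and sum: "(a + b) * q < 1"
  shows "(a / (1 - a)) * (b / (1 - b)) * (2 * q - 1)\<^sup>2 < 1"
proof -
  define s where "s = a + b"
  have "4 * (a * b) \<le> s\<^sup>2"
    using zero_le_power2[of "a - b"] by (simp add: s_def power2_eq_square algebra_simps)
  then have "4 * (a * b) * (q * (q - 1)) \<le> s\<^sup>2 * (q * (q - 1))"
    using q by (intro mult_right_mono) auto
  also have "\<dots> = (s * q) * (s * (q - 1))" by (simp add: power2_eq_square)
  also have "\<dots> \<le> 1 * (s * (q - 1))"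
    using sum ab q by (intro mult_right_mono) (auto simp: s_def)
  also have "\<dots> < 1 - s" using sum by (simp add: s_def algebra_simps)
  finally have "a * b * (2 * q - 1)\<^sup>2 < (1 - a) * (1 - b)"
    by (simp add: s_def power2_eq_square algebra_simps)
  moreover have "(a / (1 - a)) * (b / (1 - b)) * (2 * q - 1)\<^sup>2
      = a * b * (2 * q - 1)\<^sup>2 / ((1 - a) * (1 - b))" by simp
  ultimately show ?thesis using ab by (simp add: pos_divide_less_eq)
qed

lemma prod_periodic_shift:
  fixes h :: "nat \<Rightarrow> 'b::comm_monoid_mult"
  assumes "g > 0" "h g = h 0"
  shows "(\<Prod>i<g. h (Suc i)) = (\<Prod>i<g. h i)"
proof -
  obtain k where k: "g = Suc k" using assms gr0_implies_Suc by blast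
  have "(\<Prod>i<g. h (Suc i)) = (\<Prod>i<k. h (Suc i)) * h 0"
    using assms(2) by (simp only: k prod.lessThan_Suc)
  also have "\<dots> = (\<Prod>i<g. h i)"
    by (simp only: k prod.lessThan_Suc_shift mult.commute)
  finally show ?thesis .
qed

text \<open>
  Consecutive ratios are written as \<open>(1 + s) / sqrt 2\<close>, where \<open>s\<close> is the share of the growing
  exponential. The odds \<open>s / (1 - s)\<close> at the two ends of an edge multiply to \<open>1/2\<close>, so the product
  of all odds around the cycle is \<open>2^-g\<close>, while each vertex bounds the product of its two odds.
\<close>

lemma cyclic_ratio_product_bound:
  fixes x :: "nat \<Rightarrow> real" and m :: "nat \<Rightarrow> nat"
  assumes g: "g > 0"
    and pos: "\<And>i. x i > 0"
    and per: "\<And>i. x (i + g) = x i" and perm: "\<And>i. m (i + g) = m i"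
    and ineq: "\<And>i. x i + x (Suc (Suc i)) + sqrt 2 * (2 ^ m (Suc i) - 1) / (2 ^ (m (Suc i) + 1) - 1) * x (Suc i)
                 < 3 / sqrt 2 * x (Suc i)"
  shows "(\<Prod>i<g. (2 ^ (m i + 2) - 3)\<^sup>2) < (2::real) ^ g"
proof -
  \<comment> \<open>\<open>a i\<close> and \<open>b i\<close> are the shares for the edge from
    \<open>i\<close> to \<open>Suc i\<close>, read forwards and backwards: for
    \<open>x i = c + d\<close> and \<open>x (Suc i) = c * sqrt 2 + d / sqrt 2\<close>,
    \<open>a i = c / (c + d)\<close>.\<close>
  define a where "a i = sqrt 2 * x (Suc i) / x i - 1" for i
  define b where "b i = sqrt 2 * x i / x (Suc i) - 1" for i
  have per_ab: "a (i + g) = a i" "b (i + g) = b i" for i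
    using per[of "Suc i"] per[of i] by (simp_all add: a_def b_def)
  have prod2: "(1 + a i) * (1 + b i) = 2" for i
    using pos[of i] pos[of "Suc i"] by (simp add: a_def b_def field_simps)
  have gt: "a i > -1" "b i > -1" for i
    using pos[of i] pos[of "Suc i"] by (simp_all add: a_def b_def)
  \<comment> \<open>The vertex inequality, scaled by \<open>sqrt 2 / x (Suc i)\<close>, reads
    \<open>2 + a (Suc i) + b i + (q - 1) / q < 3\<close>, the last summand on the left being the
    pendant contribution.\<close>
  have sum: "(a (Suc i) + b i) * (2 ^ (m (Suc i) + 1) - 1) < 1" for i
  proof -
    define y where "y = x (Suc i)"
    define q :: real where "q = 2 ^ (m (Suc i) + 1) - 1"
    have y: "y > 0" using pos by (simp add: y_def)
    have q: "q \<ge> 1" unfolding q_def using power_increasing[of 1 "m (Suc i) + 1" "2::real"] by simp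
    have qm: "2 * (2 ^ m (Suc i) - 1) = q - 1" by (simp add: q_def)
    have "sqrt 2 * (x i + x (Suc (Suc i)) + sqrt 2 * (2 ^ m (Suc i) - 1) / q * y) < sqrt 2 * (3 / sqrt 2 * y)"
      using ineq[of i] unfolding y_def q_def by (rule mult_strict_left_mono) simp
    also have "sqrt 2 * (x i + x (Suc (Suc i)) + sqrt 2 * (2 ^ m (Suc i) - 1) / q * y)
        = sqrt 2 * x i + sqrt 2 * x (Suc (Suc i)) + (sqrt 2 * sqrt 2) * (2 ^ m (Suc i) - 1) / q * y"
      by (simp add: algebra_simps)
    also have "\<dots> = (2 + a (Suc i) + b i) * y + (q - 1) / q * y"
      using y unfolding qm[symmetric] by (simp add: a_def b_def y_def[symmetric] field_simps)
    finally have "(2 + a (Suc i) + b i + (q - 1) / q) * y < 3 * y" by (simp add: distrib_right)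
    then have "2 + a (Suc i) + b i + (q - 1) / q < 3" using y by simp
    then have "(a (Suc i) + b i) * q < 1" using q by (simp add: field_simps)
    then show ?thesis by (simp only: q_def)
  qed
  have sum1: "a (Suc i) + b i < 1" for i
  proof -
    have "(2::real) ^ (m (Suc i) + 1) - 1 \<ge> 1"
      using power_increasing[of 1 "m (Suc i) + 1" "2::real"] by simp
    then show ?thesis using sum[of i] mult_mono[of 1 "a (Suc i) + b i" 1] by fastforce
  qed
  have ge2: "q \<ge> 2" if "p * q = 2" "p \<le> 1" "q > 0" for p q :: real
    using mult_right_mono[of p 1 q] that by simp
  have lt2: "q < 2" if "p * q = 2" "p > 1" "q > 0" for p q :: real
    using mult_strict_right_mono[of 1 p q] that by simp
  have sqrt_less: "y < sqrt 2 * y" if "y > 0" for y :: real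
    using mult_strict_right_mono[of 1 "sqrt 2" y] that by simp
  \<comment> \<open>A nonpositive \<open>a i\<close> forces \<open>b i >= 1\<close>, hence
    \<open>a (Suc i) < 0\<close>. This propagates around the cycle, and \<open>x\<close> would
    decrease strictly over a full period.\<close>
  have a_pos: "a i > 0" for i
  proof (rule ccontr)
    assume "\<not> a i > 0"
    then have "a (i + k) \<le> 0" for k
    proof (induction k)
      case (Suc k)
      then have "1 + a (i + k) \<le> 1" by simp
      then have "b (i + k) \<ge> 1" using ge2[OF prod2[of "i + k"]] gt(2)[of "i + k"] by simp
      with sum1[of "i + k"] show ?case by simp
    qed simp
    note a_le = this
    have "sqrt 2 * x (Suc (i + k)) \<le> x (i + k)" for k
      using a_le[of k] pos[of "i + k"] unfolding a_def by (simp add: divide_le_eq)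
    then have dec: "x (Suc (i + k)) < x (i + k)" for k
      using sqrt_less[OF pos] by (meson less_le_trans)
    have "x (i + Suc k) < x i" for k
    proof (induction k)
      case (Suc k) then show ?case using dec[of "Suc k"] by simp
    qed (use dec[of 0] in simp)
    from this[of "g - 1"] g per[of i] show False by simp
  qed
  \<comment> \<open>The mirror image: a nonpositive share now propagates backwards, so the induction
    descends from \<open>i + g\<close>.\<close>
  have b_pos: "b i > 0" for i
  proof (rule ccontr)
    assume b: "\<not> b i > 0"
    have "b (i + g - k) \<le> 0" if "k \<le> g" for k
      using that
    proof (induction k)
      case 0 then show ?case using b per_ab(2)[of i] by simp
    next
      case (Suc k)
      define j where "j = i + g - Suc k"
      have j: "i + g - k = Suc j" using Suc.prems by (simp add: j_def)
      have "1 + b (Suc j) \<le> 1" using Suc j by simp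
      then have "a (Suc j) \<ge> 1"
        using ge2[of "1 + b (Suc j)" "1 + a (Suc j)"] prod2[of "Suc j"] gt(1)[of "Suc j"]
        by (simp add: mult.commute)
      with sum1[of j] show ?case by (simp add: j_def)
    qed
    note b_le = this
    have "sqrt 2 * x (i + k) \<le> x (Suc (i + k))" if "k \<le> g" for k
      using that b_le[of "g - k"] pos[of "Suc (i + k)"] unfolding b_def by (simp add: divide_le_eq)
    then have inc: "x (i + k) < x (Suc (i + k))" if "k \<le> g" for k
      using sqrt_less[OF pos] that by (meson less_le_trans)
    have "x i < x (i + Suc k)" if "k \<le> g" for k
      using that
    proof (induction k)
      case (Suc k) then show ?case using inc[of "Suc k"] by simp
    qed (use inc[of 0] in simp)
    from this[of "g - 1"] g per[of i] show False by simp
  qed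
  have lt1: "a i < 1" "b i < 1" for i
    using lt2[of "1 + b i" "1 + a i"] lt2[of "1 + a i" "1 + b i"] prod2[of i] a_pos[of i] b_pos[of i]
    by (simp_all add: mult.commute)
  define u where "u i = a i / (1 - a i)" for i
  define w where "w i = b i / (1 - b i)" for i
  have uw_pos: "u i > 0" "w i > 0" for i
    using a_pos b_pos lt1 by (simp_all add: u_def w_def)
  have uw: "u i * w i = 1 / 2" for i
  proof -
    have "2 * (a i * b i) = (1 - a i) * (1 - b i)" using prod2[of i] by (simp add: algebra_simps)
    moreover have "u i * w i = a i * b i / ((1 - a i) * (1 - b i))" by (simp add: u_def w_def)
    ultimately show ?thesis using a_pos[of i] b_pos[of i]
      by (metis divide_divide_eq_left' divide_self less_irrefl mult_pos_pos)
  qed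
  define P :: "nat \<Rightarrow> real" where "P i = (2 ^ (m i + 2) - 3)\<^sup>2" for i
  have P_pos: "P i > 0" for i
  proof -
    have "(2::real) ^ (m i + 2) \<ge> 4" using power_increasing[of 2 "m i + 2" "2::real"] by simp
    then have "(2::real) ^ (m i + 2) - 3 \<noteq> 0" by linarith
    then show ?thesis unfolding P_def by (subst zero_less_power2)
  qed
  have vertex: "u (Suc i) * w i * P (Suc i) < 1" for i
  proof -
    have "(2::real) ^ (m (Suc i) + 1) - 1 \<ge> 1"
      using power_increasing[of 1 "m (Suc i) + 1" "2::real"] by simp
    moreover have "2 * ((2::real) ^ (m (Suc i) + 1) - 1) - 1 = 2 ^ (m (Suc i) + 2) - 3" by simp
    ultimately show ?thesis
      using odds_product_less[OF a_pos lt1(1) b_pos lt1(2) _ sum, of i] unfolding u_def w_def P_def by metis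
  qed
  \<comment> \<open>Each factor joins the odds of the two different edges meeting at vertex
    \<open>Suc i\<close>. After a cyclic shift of \<open>u\<close> the odds are paired by edge
    instead, where \<open>uw\<close> evaluates them.\<close>
  have "(\<Prod>i<g. u (Suc i) * w i * P (Suc i)) < (\<Prod>i<g. 1)"
    using g vertex uw_pos P_pos
    by (intro prod_mono_strict[of 0]) (auto intro!: mult_nonneg_nonneg less_imp_le)
  also have "(\<Prod>i<g. u (Suc i) * w i * P (Suc i)) = (\<Prod>i<g. u (Suc i)) * (\<Prod>i<g. w i) * (\<Prod>i<g. P (Suc i))"
    by (simp add: prod.distrib)
  also have "(\<Prod>i<g. u (Suc i)) = (\<Prod>i<g. u i)"
    using g per_ab[of 0] by (intro prod_periodic_shift) (auto simp: u_def)
  also have "(\<Prod>i<g. P (Suc i)) = (\<Prod>i<g. P i)"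
    using g perm[of 0] by (intro prod_periodic_shift) (auto simp: P_def)
  also have "(\<Prod>i<g. u i) * (\<Prod>i<g. w i) = (1 / 2) ^ g"
    by (simp add: prod.distrib[symmetric] uw)
  finally show ?thesis by (simp add: P_def power_divide field_simps)
qed

section \<open>Arithmetic of the pendant lengths\<close>

text \<open>The quotient of the two sides is \<open>4 - 3 / 2 ^ a\<close>, increasing in
  \<open>a\<close>. Its values 1, 5/2 and 13/4 at \<open>a = 0, 1, 2\<close> are the constants of
  this lemma and the next two.\<close>

lemma power_two_le_pendant_factor: "(2::nat) ^ a \<le> 2 ^ (a + 2) - 3"
proof -
  have "(1::nat) \<le> 2 ^ a" by simp
  then show ?thesis by simp
qed

lemma pendant_factor_ge1:
  assumes "a \<ge> 1" shows "5 * (2::nat) ^ a \<le> 2 * (2 ^ (a + 2) - 3)"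
proof -
  have "(2::nat) \<le> 2 ^ a" using assms power_increasing[of 1 a "2::nat"] by simp
  then show ?thesis by simp
qed

lemma pendant_factor_ge2:
  assumes "a \<ge> 2" shows "13 * (2::nat) ^ a \<le> 4 * (2 ^ (a + 2) - 3)"
proof -
  have "(4::nat) \<le> 2 ^ a" using assms power_increasing[of 2 a "2::nat"] by simp
  then show ?thesis by simp
qed

text \<open>Converts a gain \<open>c / d\<close> over \<open>2 ^ e\<close> into extra cycle length:
  \<open>(c / d)^2 >= 2 ^ k\<close> yields \<open>2 ^ (2 * e + k) <= F^2 < 2 ^ g\<close>. Numerator
  and denominator are kept apart to stay in the naturals.\<close>

lemma exponent_less_of_factor:
  fixes c d F g e :: nat
  assumes F: "c * 2 ^ e \<le> d * F" and c: "2 ^ k * d\<^sup>2 \<le> c\<^sup>2" and "d > 0" and lt: "F\<^sup>2 < 2 ^ g"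
  shows "2 * e + k < g"
proof -
  have "2 ^ (2 * e + k) * d\<^sup>2 = (2 ^ e)\<^sup>2 * (2 ^ k * d\<^sup>2)"
    by (simp add: power_add power_even_eq)
  also have "\<dots> \<le> (2 ^ e)\<^sup>2 * c\<^sup>2" using c by simp
  also have "\<dots> = (c * 2 ^ e)\<^sup>2" by (simp add: power_mult_distrib)
  also have "\<dots> \<le> (d * F)\<^sup>2" using F by (rule power_mono) simp
  also have "\<dots> = F\<^sup>2 * d\<^sup>2" by (simp add: power_mult_distrib)
  also have "\<dots> < 2 ^ g * d\<^sup>2" using lt \<open>d > 0\<close> by simp
  finally have "(2::nat) ^ (2 * e + k) < 2 ^ g" using \<open>d > 0\<close> by simp
  then show ?thesis by simp
qed

text \<open>Here \<open>s\<close> stands for two pendant lengths and \<open>t\<close> for the total.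
  Even \<open>g\<close> is the critical parity: it needs \<open>g div 2 >= s + 4\<close>, which an
  even number at least \<open>2 * s + 7\<close> satisfies.\<close>

lemma half_bound_two:
  fixes g s t :: nat
  assumes "g \<ge> 2 * s + 7" "s \<le> t" shows "3 * (s + g div 2) + 4 \<le> 2 * (g + t)"
proof -
  obtain h where h: "g div 2 = h" "g = 2 * h \<or> g = 2 * h + 1" by (metis dvd_mult_div_cancel odd_two_times_div_two_succ)
  then have "g = 2 * h \<Longrightarrow> h \<ge> s + 4" using assms by presburger
  with h assms show ?thesis by auto
qed

text \<open>For odd \<open>g\<close> both claims only need \<open>g div 2 >= a + 2\<close>. For even
  \<open>g\<close> the second needs \<open>g div 2 >= a + 4\<close> when \<open>s = a\<close>, hence
  the two excluded values.\<close>

lemma half_bound_one: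
  fixes g s a :: nat
  assumes "g \<ge> 2 * a + 4" "s \<le> a"
  shows "3 * (s + g div 2) + 2 \<le> 2 * (g + a)"
    and "g \<noteq> 2 * a + 4 \<Longrightarrow> g \<noteq> 2 * a + 6 \<Longrightarrow> 3 * (s + g div 2) + 4 \<le> 2 * (g + a)"
proof -
  obtain h where h: "g div 2 = h" "g = 2 * h \<or> g = 2 * h + 1" by (metis dvd_mult_div_cancel odd_two_times_div_two_succ)
  then show "3 * (s + g div 2) + 2 \<le> 2 * (g + a)" using assms by auto
  assume "g \<noteq> 2 * a + 4" "g \<noteq> 2 * a + 6"
  then have "g = 2 * h \<Longrightarrow> h \<ge> a + 4" using assms by presburger
  with h assms show "3 * (s + g div 2) + 4 \<le> 2 * (g + a)" by auto
qed

text \<open>All that is retained from the spectral hypothesis. The subtraction never truncates,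
  since \<open>2 ^ (m i + 2) >= 4\<close>.\<close>

locale pendant_lengths =
  fixes g :: nat and m :: "nat \<Rightarrow> nat"
  assumes prod_bound: "(\<Prod>i<g. (2 ^ (m i + 2) - 3)\<^sup>2) < (2::nat) ^ g"
begin

lemma factor_ge1: "(2::nat) ^ (m i + 2) - 3 \<ge> 1"
  using power_two_le_pendant_factor[of "m i"] by (meson le_trans one_le_numeral one_le_power)

lemma partial_prod_bound:
  assumes "I \<subseteq> {..<g}" shows "(\<Prod>i\<in>I. 2 ^ (m i + 2) - 3)\<^sup>2 < (2::nat) ^ g"
proof -
  have "(\<Prod>i\<in>I. 2 ^ (m i + 2) - 3)\<^sup>2 = (\<Prod>i\<in>I. ((2::nat) ^ (m i + 2) - 3)\<^sup>2)"
    by (simp add: prod_power_distrib)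
  also have "\<dots> \<le> (\<Prod>i<g. (2 ^ (m i + 2) - 3)\<^sup>2)"
  proof -
    have "(\<Prod>i\<in>{..<g} - I. ((2::nat) ^ (m i + 2) - 3)\<^sup>2) > 0"
      using factor_ge1 by (intro prod_pos) (simp add: Suc_le_eq)
    then have "1 * (\<Prod>i\<in>I. (2 ^ (m i + 2) - 3)\<^sup>2)
        \<le> (\<Prod>i\<in>{..<g} - I. ((2::nat) ^ (m i + 2) - 3)\<^sup>2) * (\<Prod>i\<in>I. (2 ^ (m i + 2) - 3)\<^sup>2)"
      by (intro mult_le_mono1) linarith
    then show ?thesis using prod.subset_diff[OF assms, of "\<lambda>i. ((2::nat) ^ (m i + 2) - 3)\<^sup>2"] by simp
  qed
  finally show ?thesis using prod_bound by simp
qed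

lemma twice_sum_less: "2 * (\<Sum>i<g. m i) < g"
proof -
  have "(1::nat) * 2 ^ (\<Sum>i<g. m i) \<le> 1 * (\<Prod>i<g. 2 ^ (m i + 2) - 3)"
    unfolding power_sum using power_two_le_pendant_factor by (simp add: prod_mono)
  from exponent_less_of_factor[OF this, of 0 g] partial_prod_bound[of "{..<g}"] show ?thesis
    by simp
qed

text \<open>Two pendants gain \<open>(5/2)^2 = 25/4\<close>, whose square exceeds
  \<open>2 ^ 5\<close>; if one has length at least 2 they gain \<open>65/8\<close>, whose square
  exceeds \<open>2 ^ 6\<close>, and \<open>half_bound_two\<close> applies. Only two pendants of
  length 1 remain.\<close>

lemma two_pendants_bound:
  assumes ij: "i < g" "j < g" "i \<noteq> j" and pos: "m i \<ge> 1" "m j \<ge> 1"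
    and n: "n = g + (\<Sum>i<g. m i)" "n \<ge> 13"
  shows "3 * (m i + m j + g div 2) + 4 \<le> 2 * n"
proof -
  define F :: nat where "F = (2 ^ (m i + 2) - 3) * (2 ^ (m j + 2) - 3)"
  have F: "F\<^sup>2 < 2 ^ g" using partial_prod_bound[of "{i, j}"] ij by (simp add: F_def)
  have "(5 * 2 ^ m i) * (5 * 2 ^ m j) \<le> (2 * (2 ^ (m i + 2) - 3)) * (2 * ((2::nat) ^ (m j + 2) - 3))"
    using pos by (intro mult_le_mono pendant_factor_ge1)
  then have "25 * 2 ^ (m i + m j) \<le> 4 * F" by (simp add: F_def power_add mult_ac)
  from exponent_less_of_factor[OF this, of 5 g] F have g6: "g \<ge> 2 * (m i + m j) + 6" by simp
  have g7: "g \<ge> 2 * (m i + m j) + 7" if "m i \<ge> 2 \<or> m j \<ge> 2"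
  proof -
    have "65 * 2 ^ (m i + m j) \<le> 8 * F"
    proof (cases "m i \<ge> 2")
      case True
      have "(13 * 2 ^ m i) * (5 * 2 ^ m j) \<le> (4 * (2 ^ (m i + 2) - 3)) * (2 * ((2::nat) ^ (m j + 2) - 3))"
        using pos True by (intro mult_le_mono pendant_factor_ge1 pendant_factor_ge2)
      then show ?thesis by (simp add: F_def power_add mult_ac)
    next
      case False
      have "(5 * 2 ^ m i) * (13 * 2 ^ m j) \<le> (2 * (2 ^ (m i + 2) - 3)) * (4 * ((2::nat) ^ (m j + 2) - 3))"
        using pos False that by (intro mult_le_mono pendant_factor_ge1 pendant_factor_ge2) auto
      then show ?thesis by (simp add: F_def power_add mult_ac)
    qed
    from exponent_less_of_factor[OF this, of 6 g] F show ?thesis by simp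
  qed
  have "sum m {i, j} \<le> sum m {..<g}" using ij by (intro sum_mono2) auto
  then have "m i + m j \<le> (\<Sum>i<g. m i)" using ij by simp
  note le = this
  show ?thesis
  proof (cases "m i \<ge> 2 \<or> m j \<ge> 2")
    case True
    from half_bound_two[OF g7[OF True] le] show ?thesis using n by simp
  next
    case False
    then have mm: "m i = 1" "m j = 1" using pos by auto
    obtain h where h: "g div 2 = h" "g = 2 * h \<or> g = 2 * h + 1"
      by (metis dvd_mult_div_cancel odd_two_times_div_two_succ)
    \<comment> \<open>The bound \<open>n >= 13\<close> decides the smallest case: for
      \<open>g = 10\<close> the claim reads \<open>25 <= 2 * n\<close>.\<close>
    then have "h \<ge> 5" using g6 mm by auto
    then show ?thesis using le n mm h by auto
  qed
qed

text \<open>For length at least 2 the gain \<open>13/4\<close> suffices, as its square exceeds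
  \<open>2 ^ 3\<close>; for length 1 the size bound already gives \<open>g >= 12\<close>.\<close>

lemma one_pendant_bound:
  assumes i: "i < g" "m i \<ge> 1" and others: "\<And>j. j < g \<Longrightarrow> j \<noteq> i \<Longrightarrow> m j = 0"
    and n: "n = g + (\<Sum>i<g. m i)" "n \<ge> 13"
  shows "n = g + m i" "g \<ge> 2 * m i + 4"
proof -
  have "(\<Sum>j<g. m j) = m i"
    using i others by (subst sum.remove[of _ i]) auto
  then show n': "n = g + m i" using n by simp
  have F: "(2 ^ (m i + 2) - 3)\<^sup>2 < (2::nat) ^ g" using partial_prod_bound[of "{i}"] i by simp
  show "g \<ge> 2 * m i + 4"
  proof (cases "m i \<ge> 2")
    case True
    from exponent_less_of_factor[OF pendant_factor_ge2[OF True], of 3 g] F show ?thesis by simp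
  qed (use n' n i in linarith)
qed

lemma pair_bound:
  assumes ij: "i < g" "j < g" "i \<noteq> j" and n: "n = g + (\<Sum>i<g. m i)" "n \<ge> 13"
  shows "3 * (m i + m j + g div 2) + 2 \<le> 2 * n"
    and "3 * (m i + m j + g div 2) + 4 \<le> 2 * n \<or>
      (\<exists>k<g. m k \<ge> 1 \<and> (\<forall>l<g. l \<noteq> k \<longrightarrow> m l = 0) \<and> (g = 2 * m k + 4 \<or> g = 2 * m k + 6))"
proof -
  \<comment> \<open>The exceptional alternative also carries the weaker inequality, so that both
    conclusions follow from one case analysis.\<close>
  have "3 * (m i + m j + g div 2) + 4 \<le> 2 * n \<or>
      (\<exists>k<g. m k \<ge> 1 \<and> (\<forall>l<g. l \<noteq> k \<longrightarrow> m l = 0) \<and> (g = 2 * m k + 4 \<or> g = 2 * m k + 6)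
         \<and> 3 * (m i + m j + g div 2) + 2 \<le> 2 * n)"
  proof (cases "\<exists>k<g. m k \<ge> 1")
    case False
    then have "n = g" and "m i = 0" "m j = 0" using n ij by auto
    then show ?thesis using half_bound_two[of 0 g 0] n by simp
  next
    case True
    then obtain k0 where k0: "k0 < g" "m k0 \<ge> 1" by blast
    show ?thesis
    proof (cases "\<exists>k<g. \<exists>l<g. k \<noteq> l \<and> m k \<ge> 1 \<and> m l \<ge> 1 \<and> m i + m j \<le> m k + m l")
      case True
      then obtain k l where "k < g" "l < g" "k \<noteq> l" "m k \<ge> 1" "m l \<ge> 1" and le: "m i + m j \<le> m k + m l"
        by blast
      from two_pendants_bound[OF this(1-5) n] le
      have "3 * (m i + m j + g div 2) + 4 \<le> 2 * n"
        by (meson add_le_mono1 le_trans mult_le_mono2)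
      then show ?thesis by blast
    next
      case no_pair: False
      \<comment> \<open>With no dominating pair of nonempty pendants, at most one of
        \<open>i\<close> and \<open>j\<close> carries a pendant. That one, or any pendant if neither
        does, must be the only pendant: a second one would form a dominating pair with it.\<close>
      define k where "k = (if m i \<ge> 1 then i else if m j \<ge> 1 then j else k0)"
      have k: "k < g" "m k \<ge> 1" and le: "m i + m j \<le> m k"
      proof -
        have "m i = 0 \<or> m j = 0"
        proof (rule ccontr)
          assume "\<not> ?thesis"
          then have "m i \<ge> 1" "m j \<ge> 1" by auto
          with no_pair ij show False by blast
        qed
        then show "k < g" "m k \<ge> 1" "m i + m j \<le> m k"
          using ij k0 by (auto simp: k_def)
      qed
      have others: "m l = 0" if "l < g" "l \<noteq> k" for l
      proof (rule ccontr)
        assume "m l \<noteq> 0"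
        then have "m l \<ge> 1" "m i + m j \<le> m k + m l" using le by auto
        with no_pair k that show False by blast
      qed
      from one_pendant_bound[OF k others n] have ng: "n = g + m k" "g \<ge> 2 * m k + 4" by auto
      show ?thesis using half_bound_one[OF ng(2) le] k others unfolding ng(1) by blast
    qed
  qed
  then show "3 * (m i + m j + g div 2) + 2 \<le> 2 * n"
    and "3 * (m i + m j + g div 2) + 4 \<le> 2 * n \<or>
      (\<exists>k<g. m k \<ge> 1 \<and> (\<forall>l<g. l \<noteq> k \<longrightarrow> m l = 0) \<and> (g = 2 * m k + 4 \<or> g = 2 * m k + 6))"
    by (auto elim!: disjE)
qed

end

section \<open>Labelling a closed quipu\<close>

text \<open>Each edge appears in one orientation only. \<open>m i = 0\<close> encodes a cycle vertex
  without pendant, so all cycle vertices are treated uniformly.\<close>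

definition labelled_edges :: "nat \<Rightarrow> (nat \<Rightarrow> nat) \<Rightarrow> (nat \<Rightarrow> nat \<Rightarrow> 'a) \<Rightarrow> ('a \<times> 'a) set" where
  "labelled_edges g m \<phi> = {(\<phi> i j, \<phi> i (Suc j)) | i j. i < g \<and> j < m i}
     \<union> {(\<phi> i 0, \<phi> (Suc i mod g) 0) | i. i < g}"

locale quipu_labelling = pair_graph G for G :: "'a pair_pre_digraph" +
  fixes g :: nat and m :: "nat \<Rightarrow> nat" and \<phi> :: "nat \<Rightarrow> nat \<Rightarrow> 'a"
  assumes cycle_length: "3 \<le> g"
    and bij: "bij_betw (\<lambda>(i, j). \<phi> i j) (SIGMA i:{..<g}. {..m i}) (pverts G)"
    and arcs_eq: "parcs G = labelled_edges g m \<phi> \<union> (labelled_edges g m \<phi>)\<inverse>"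

section \<open>Cycles as arc lists\<close>

lemma pawalk_verts_eq: "pcas u p v \<Longrightarrow> pawalk_verts u p = u # map snd p"
  by (induction p arbitrary: u) auto

lemma pcas_fst_Suc: "pcas u p v \<Longrightarrow> Suc i < length p \<Longrightarrow> fst (p ! Suc i) = snd (p ! i)"
proof (induction p arbitrary: u i)
  case (Cons e p)
  then show ?case
    by (cases i; cases p) auto
qed simp

lemma pcas_fst_0: "pcas u p v \<Longrightarrow> p \<noteq> [] \<Longrightarrow> fst (p ! 0) = u"
  by (cases p) auto

lemma pcas_snd_last: "pcas u p v \<Longrightarrow> p \<noteq> [] \<Longrightarrow> snd (p ! (length p - 1)) = v"
proof (induction p arbitrary: u)
  case (Cons e p)
  then show ?case by (cases p) auto
qed simp

lemma (in pair_graph) cycle_vertices: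
  assumes "cycle p"
  defines "g \<equiv> length p"
  shows "distinct (map snd p)"
    and "\<And>i. i < g \<Longrightarrow> p ! (Suc i mod g) = (snd (p ! i), snd (p ! (Suc i mod g)))"
proof -
  from assms obtain u where u: "awalk u p u" "distinct (tl (pawalk_verts u p))" "p \<noteq> []"
    by (auto simp: cycle_def)
  then have cas: "pcas u p u" by (simp add: awalk_def)
  show "distinct (map snd p)" using u(2) by (simp add: pawalk_verts_eq[OF cas])
  fix i assume i: "i < g"
  show "p ! (Suc i mod g) = (snd (p ! i), snd (p ! (Suc i mod g)))"
  proof (cases "Suc i < g")
    case True
    then show ?thesis using pcas_fst_Suc[OF cas] unfolding g_def
      by (metis mod_less prod.collapse)
  next
    case False
    then have "Suc i = g" using i by simp
    then have "Suc i mod g = 0" "i = length p - 1" by (simp_all add: g_def)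
    then show ?thesis using pcas_fst_0[OF cas u(3)] pcas_snd_last[OF cas u(3)]
      by (metis prod.collapse)
  qed
qed

lemma (in pair_graph) card_neighbours_le_out_degree:
  assumes "finite N" "\<And>w. w \<in> N \<Longrightarrow> (v, w) \<in> parcs G"
  shows "card N \<le> out_degree (with_proj G) v"
proof -
  have "card N = card (Pair v ` N)" by (simp add: card_image inj_on_def)
  also have "\<dots> \<le> card (out_arcs (with_proj G) v)"
    using assms pair_finite_arcs by (intro card_mono) (auto simp: out_arcs_def)
  finally show ?thesis by (simp add: out_degree_def)
qed

text \<open>A simple path from \<open>a\<close> to \<open>b\<close> inside \<open>E\<close> is
  closed up by the reverse arc. It has at least two arcs, because \<open>(a, b)\<close> is neither a
  loop nor in \<open>E\<close>, so the cycle is a genuine one.\<close>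

lemma (in pair_graph) cycle_through_extra_edge:
  assumes E: "E \<subseteq> parcs G" and reach: "(a, b) \<in> E\<^sup>*"
    and ab: "(a, b) \<in> parcs G" "(a, b) \<notin> E"
  shows "\<exists>p. cycle p \<and> 3 \<le> length p \<and> (b, a) \<in> set p"
proof -
  define T where "T = \<lparr>pverts = pverts G, parcs = E\<rparr>"
  interpret T: pair_wf_digraph T
    using E by unfold_locales (auto simp: T_def dest: arc_fst_in_verts arc_snd_in_verts)
  have "a \<rightarrow>\<^sup>*\<^bsub>with_proj T\<^esub> b"
    using reach in_arcsD1[OF ab(1)] by (subst T.reachable_conv') (auto simp: T_def)
  then obtain p where p: "T.apath a p b" by (auto simp: T.reachable_apath)
  then have walk: "T.awalk a p b" and "distinct (pawalk_verts a p)" by (simp_all add: T.apath_def)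
  moreover from walk have cas: "pcas a p b" and "set p \<subseteq> parcs T" by (simp_all add: T.awalk_def)
  ultimately have pE: "set p \<subseteq> E" and dist: "distinct (a # map snd p)"
    by (simp_all add: T_def flip: pawalk_verts_eq[OF cas])
  have "p \<noteq> []" using cas no_loops'[OF ab(1)] by auto
  moreover have "p \<noteq> [e]" for e
    using cas pE ab(2) by (cases e) auto
  ultimately have len: "length p \<ge> 2"
    by (cases p rule: remdups_adj.cases) auto
  have "pcas u (p @ [(b, a)]) a" if "pcas u p b" for u using that by (induction p arbitrary: u) auto
  from this[OF cas] have "pcas a (p @ [(b, a)]) a" .
  moreover have "set (p @ [(b, a)]) \<subseteq> parcs G" using pE E arcs_symmetric[OF ab(1)] by auto
  ultimately have "awalk a (p @ [(b, a)]) a" using in_arcsD1[OF ab(1)] by (simp add: awalk_def)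
  moreover have "distinct (tl (pawalk_verts a (p @ [(b, a)])))"
    using dist pawalk_verts_eq[OF \<open>pcas a (p @ [(b, a)]) a\<close>] by simp
  ultimately have "cycle (p @ [(b, a)])" by (auto simp: cycle_def)
  then show ?thesis using len by (intro exI[of _ "p @ [(b, a)]"]) auto
qed

lemma pred_mod_Suc:
  fixes i g :: nat
  assumes "i < g" shows "Suc ((i + g - 1) mod g) mod g = i"
proof -
  have "Suc ((i + g - 1) mod g) mod g = Suc (i + g - 1) mod g" by (simp add: mod_Suc_eq)
  also have "Suc (i + g - 1) = i + g" using assms by simp
  finally show ?thesis using assms by simp
qed

lemma mod_neq_Suc_Suc_mod:
  fixes i g :: nat
  assumes "3 \<le> g" shows "i mod g \<noteq> Suc (Suc i) mod g"
proof
  assume "i mod g = Suc (Suc i) mod g"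
  then have "g dvd Suc (Suc i) - i" using mod_eq_dvd_iff_nat[of i "Suc (Suc i)" g] by simp
  then have "g dvd 2" by simp
  then have "g \<le> 2" by (rule dvd_imp_le) simp
  with assms show False by simp
qed

lemma pred_mod_neq_Suc_mod:
  fixes i g :: nat
  assumes "3 \<le> g" shows "(i + g - 1) mod g \<noteq> Suc i mod g"
proof -
  have "Suc (Suc (i + g - 1)) = Suc i + g" using assms by simp
  then show ?thesis using mod_neq_Suc_Suc_mod[OF assms, of "i + g - 1"] by (metis mod_add_self2)
qed

text \<open>
  Among all families of disjoint paths hanging off the cycle take one of maximal total length: by the
  degree conditions it covers every vertex. A remaining edge would close a second cycle.
\<close>

theorem closed_quipu_labelling:
  assumes cq: "closed_quipu G"
  shows "\<exists>g m \<phi>. quipu_labelling G g m \<phi>"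
proof -
  from cq interpret pair_graph G by (simp add: closed_quipu_def)
  let ?V = "pverts G"
  from cq have conn: "Digraph_Component.connected (with_proj G)"
    and deg: "\<And>v. v \<in> ?V \<Longrightarrow> out_degree (with_proj G) v \<le> 3"
    and uniq: "\<And>C D. C \<in> graph_cycles G \<Longrightarrow> D \<in> graph_cycles G \<Longrightarrow> C = D"
    and deg3: "\<And>C v. C \<in> graph_cycles G \<Longrightarrow> v \<in> ?V \<Longrightarrow> out_degree (with_proj G) v = 3 \<Longrightarrow> v \<in> \<Union>C"
    and ex: "\<exists>C. C \<in> graph_cycles G"
    by (auto simp: closed_quipu_def)
  from ex obtain p where p: "cycle p" "3 \<le> length p" by (auto simp: graph_cycles_def)
  define C where "C = (\<lambda>(u, v). {u, v}) ` set p"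
  have C: "C \<in> graph_cycles G" using p by (auto simp: C_def graph_cycles_def)
  define g where "g = length p"
  define c where "c i = snd (p ! i)" for i
  have g3: "3 \<le> g" using p by (simp add: g_def)
  have c_inj: "c i = c j \<longleftrightarrow> i = j" if "i < g" "j < g" for i j
    using nth_eq_iff_index_eq[OF cycle_vertices(1)[OF p(1)], of i j] that by (simp add: c_def g_def)
  have p_nth: "p ! (Suc i mod g) = (c i, c (Suc i mod g))" if "i < g" for i
    using cycle_vertices(2)[OF p(1)] that by (simp add: c_def g_def)
  have set_p: "set p = {(c i, c (Suc i mod g)) | i. i < g}"
  proof (intro equalityI subsetI)
    fix e assume "e \<in> set p"
    then obtain k where k: "k < g" "e = p ! k" by (auto simp: in_set_conv_nth g_def)
    define i where "i = (k + g - 1) mod g"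
    have "i < g" "Suc i mod g = k" using k g3 pred_mod_Suc[OF k(1)] by (auto simp: i_def)
    with p_nth[of i] k show "e \<in> {(c i, c (Suc i mod g)) | i. i < g}" by auto
  next
    fix e assume "e \<in> {(c i, c (Suc i mod g)) | i. i < g}"
    then obtain i where "i < g" "e = (c i, c (Suc i mod g))" by blast
    then have "e = p ! (Suc i mod g)" "Suc i mod g < g" using p_nth g3 by simp_all
    then have "e = p ! (Suc i mod g)" "Suc i mod g < length p" by (simp_all add: g_def)
    then show "e \<in> set p" by simp
  qed
  have "set p \<subseteq> parcs G" using p(1) by (auto simp: cycle_def awalk_def)
  then have c_arc: "(c i, c (Suc i mod g)) \<in> parcs G" if "i < g" for i
    using that set_p by blast
  have c_in: "c i \<in> ?V" if "i < g" for i using in_arcsD1[OF c_arc[OF that]] .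
  have C_verts: "\<exists>i<g. v = c i" if "v \<in> \<Union>C" for v
  proof -
    from that obtain i where "i < g" "v \<in> {c i, c (Suc i mod g)}" by (auto simp: C_def set_p)
    moreover have "Suc i mod g < g" using g3 by simp
    ultimately show ?thesis by blast
  qed

  define S where "S m = (SIGMA i:{..<g}. {..m i})" for m :: "nat \<Rightarrow> nat"
  \<comment> \<open>Injectivity on \<open>S m\<close> says at once that the paths are simple,
    pairwise disjoint, and meet the cycle only in their roots.\<close>
  define valid where "valid = (\<lambda>(m :: nat \<Rightarrow> nat, \<phi> :: nat \<Rightarrow> nat \<Rightarrow> 'a).
    inj_on (\<lambda>(i, j). \<phi> i j) (S m) \<and> (\<lambda>(i, j). \<phi> i j) ` S m \<subseteq> ?V \<and> (\<forall>i<g. \<phi> i 0 = c i) \<and>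
    (\<forall>i<g. \<forall>j<m i. (\<phi> i j, \<phi> i (Suc j)) \<in> parcs G))"
  define total where "total = (\<lambda>(m :: nat \<Rightarrow> nat, \<phi> :: nat \<Rightarrow> nat \<Rightarrow> 'a). \<Sum>i<g. m i)"
  have "valid (\<lambda>_. 0, \<lambda>i _. c i)"
    using c_inj c_in by (auto simp: valid_def S_def inj_on_def)
  moreover have "total y < Suc (card ?V)" if "valid y" for y
  proof -
    obtain m \<phi> where y: "y = (m, \<phi>)" by (cases y)
    have "(\<Sum>i<g. Suc (m i)) = card (S m)" by (simp add: S_def)
    also have "\<dots> \<le> card ?V"
      using that pair_finite_verts by (intro card_inj_on_le) (auto simp: valid_def y)
    finally have "(\<Sum>i<g. m i) \<le> card ?V" by (simp add: sum.distrib[of m "\<lambda>_. 1", simplified])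
    then show ?thesis by (simp add: total_def y)
  qed
  ultimately obtain y where y: "valid y" "\<And>z. valid z \<Longrightarrow> total z \<le> total y"
    using ex_has_greatest_nat[of valid _ total "Suc (card ?V)"] by blast
  obtain m \<phi> where m\<phi>: "y = (m, \<phi>)" by (cases y)
  have inj: "\<phi> i j = \<phi> k l \<longleftrightarrow> i = k \<and> j = l" if "i < g" "j \<le> m i" "k < g" "l \<le> m k" for i j k l
  proof -
    have "inj_on (\<lambda>(i, j). \<phi> i j) (S m)" using y(1) by (simp add: valid_def m\<phi>)
    from inj_on_eq_iff[OF this, of "(i, j)" "(k, l)"] that show ?thesis by (simp add: S_def)
  qed
  have in_V: "\<phi> i j \<in> ?V" if "i < g" "j \<le> m i" for i j
  proof -
    have "(\<lambda>(i, j). \<phi> i j) ` S m \<subseteq> ?V" using y(1) by (simp add: valid_def m\<phi>)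
    moreover have "(i, j) \<in> S m" using that by (simp add: S_def)
    ultimately show ?thesis by force
  qed
  have \<phi>0: "\<phi> i 0 = c i" if "i < g" for i using y(1) that by (simp add: valid_def m\<phi>)
  have \<phi>_arc: "(\<phi> i j, \<phi> i (Suc j)) \<in> parcs G" if "i < g" "j < m i" for i j
    using y(1) that by (simp add: valid_def m\<phi>)
  define W where "W = (\<lambda>(i, j). \<phi> i j) ` S m"
  have W_I: "\<phi> i j \<in> W" if "i < g" "j \<le> m i" for i j
    unfolding W_def using that by (intro image_eqI[of _ _ "(i, j)"]) (auto simp: S_def)

  have closed: "w \<in> W" if ij: "i < g" "j \<le> m i" and w: "(\<phi> i j, w) \<in> parcs G" for i j w
  proof (rule ccontr)
    assume nW: "w \<notin> W"
    then have w_neq: "w \<noteq> \<phi> k l" "\<phi> k l \<noteq> w" if "k < g" "l \<le> m k" for k l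
      using W_I[OF that] by auto
    \<comment> \<open>An unlabelled neighbour \<open>w\<close> would lengthen the family at a path
      end (possibly starting a new path at a bare cycle vertex), give a cycle vertex with a pendant
      degree 4, or give an inner path vertex degree 3 off the cycle.\<close>
    consider "j = m i" | "j < m i" "j = 0" | "j < m i" "j > 0" using ij by linarith
    then show False
    proof cases
      case 1
      define m' where "m' = m(i := Suc (m i))"
      define \<phi>' where "\<phi>' = \<phi>(i := (\<phi> i)(Suc (m i) := w))"
      have \<phi>': "\<phi>' k l = (if k = i \<and> l = Suc (m i) then w else \<phi> k l)" for k l
        by (simp add: \<phi>'_def)
      have old: "k < g \<and> l \<le> m k" if "k < g" "l \<le> m' k" "\<not> (k = i \<and> l = Suc (m i))" for k l
        using that by (cases "k = i") (auto simp: m'_def)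
      have "inj_on (\<lambda>(i, j). \<phi>' i j) (S m')"
      proof (rule inj_onI, clarify)
        fix k l k' l' assume "(k, l) \<in> S m'" "(k', l') \<in> S m'" and eq: "\<phi>' k l = \<phi>' k' l'"
        then have kl: "k < g" "l \<le> m' k" "k' < g" "l' \<le> m' k'" by (auto simp: S_def)
        show "k = k' \<and> l = l'"
        proof (cases "k = i \<and> l = Suc (m i)")
          case True
          then have "\<phi>' k' l' = w" using eq by (simp add: \<phi>')
          then show ?thesis using True old[OF kl(3,4)] w_neq(2)[of k' l'] by (metis \<phi>')
        next
          case False
          then have "k < g" "l \<le> m k" and kl_eq: "\<phi>' k' l' = \<phi> k l" 
            using eq old[OF kl(1,2) False] by (auto simp: \<phi>'[of k l] split: if_splits)
          then show ?thesis using old[OF kl(3,4)] w_neq(1)[of k l] inj[of k l k' l'] by (metis \<phi>')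
        qed
      qed
      moreover have "(\<lambda>(i, j). \<phi>' i j) ` S m' \<subseteq> ?V"
      proof clarify
        fix k l assume "(k, l) \<in> S m'"
        then have "k < g" "l \<le> m' k" by (auto simp: S_def)
        then show "\<phi>' k l \<in> ?V" using old[of k l] in_V[of k l] in_arcsD2[OF w] by (auto simp: \<phi>')
      qed
      moreover have "(\<phi>' k l, \<phi>' k (Suc l)) \<in> parcs G" if "k < g" "l < m' k" for k l
        using that w 1 \<phi>_arc[of k l] by (cases "k = i") (auto simp: \<phi>' m'_def less_Suc_eq)
      moreover have "\<phi>' k 0 = c k" if "k < g" for k using \<phi>0[OF that] by (simp add: \<phi>')
      ultimately have "valid (m', \<phi>')" unfolding valid_def by simp
      then have "(\<Sum>k<g. m' k) \<le> (\<Sum>k<g. m k)" using y(2) by (fastforce simp: total_def m\<phi>)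
      moreover have "(\<Sum>k<g. m k) < (\<Sum>k<g. m' k)"
        using ij by (intro sum_strict_mono_ex1) (auto simp: m'_def)
      ultimately show False by simp
    next
      case 2
      define s where "s = Suc i mod g"
      define q where "q = (i + g - 1) mod g"
      have sq: "s < g" "q < g" "s \<noteq> q" and q: "Suc q mod g = i"
        using g3 pred_mod_neq_Suc_mod[OF g3, of i] pred_mod_Suc[OF ij(1)] by (auto simp: s_def q_def)
      define N where "N = {\<phi> s 0, \<phi> q 0, \<phi> i 1, w}"
      have "\<phi> s 0 \<noteq> \<phi> q 0" "\<phi> s 0 \<noteq> \<phi> i 1" "\<phi> q 0 \<noteq> \<phi> i 1" "\<phi> s 0 \<noteq> w" "\<phi> q 0 \<noteq> w" "\<phi> i 1 \<noteq> w"
        using sq ij 2 inj[of s 0 q 0] inj[of s 0 i 1] inj[of q 0 i 1] w_neq(2)[of s 0] w_neq(2)[of q 0] w_neq(2)[of i 1]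
        by auto
      then have "card N = 4" by (simp add: N_def)
      moreover have "(\<phi> i j, x) \<in> parcs G" if "x \<in> N" for x
        using that w 2 \<phi>_arc[of i 0] c_arc[OF ij(1)] arcs_symmetric[OF c_arc[OF sq(2)]] \<phi>0 sq ij
        unfolding N_def q by (auto simp: s_def[symmetric])
      ultimately have "4 \<le> out_degree (with_proj G) (\<phi> i j)"
        using card_neighbours_le_out_degree[of N "\<phi> i j"] by (simp add: N_def)
      with deg[OF in_V[OF ij]] show False by simp
    next
      case 3
      then obtain j' where j': "j = Suc j'" by (cases j) auto
      define N where "N = {\<phi> i j', \<phi> i (Suc j), w}"
      have "\<phi> i j' \<noteq> \<phi> i (Suc j)" "\<phi> i j' \<noteq> w" "\<phi> i (Suc j) \<noteq> w"
        using ij 3 j' inj[of i j' i "Suc j"] w_neq(2)[of i j'] w_neq(2)[of i "Suc j"] by auto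
      then have "card N = 3" by (simp add: N_def)
      moreover have "(\<phi> i j, x) \<in> parcs G" if "x \<in> N" for x
        using that w 3 \<phi>_arc[of i j] arcs_symmetric[OF \<phi>_arc[of i j']] ij j' by (auto simp: N_def)
      ultimately have "3 \<le> out_degree (with_proj G) (\<phi> i j)"
        using card_neighbours_le_out_degree[of N "\<phi> i j"] by (simp add: N_def)
      with deg[OF in_V[OF ij]] have "out_degree (with_proj G) (\<phi> i j) = 3" by simp
      from C_verts[OF deg3[OF C in_V[OF ij] this]] obtain k where "k < g" "\<phi> i j = c k" by blast
      then show False using inj[of i j k 0] \<phi>0[of k] ij 3 by auto
    qed
  qed

  have "strongly_connected (with_proj G)"
    using symmetric_connected_imp_strongly_connected[OF pair_sym_arcs conn] .
  then have reach: "u \<rightarrow>\<^sup>*\<^bsub>with_proj G\<^esub> v" if "u \<in> ?V" "v \<in> ?V" for u v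
    using that by (auto simp: strongly_connected_def)
  have "v \<in> W" if "v \<in> ?V" for v
  proof -
    have 0: "c 0 \<in> ?V" "c 0 \<in> W" using c_in[of 0] g3 W_I[of 0 0] \<phi>0[of 0] by auto
    from reach[OF 0(1) that] show ?thesis
    proof (induct rule: reachable_induct)
      case base show ?case by (rule 0)
    next
      case (step x y)
      then obtain i j where "i < g" "j \<le> m i" "x = \<phi> i j" by (auto simp: W_def S_def)
      with closed step show ?case by auto
    qed
  qed
  moreover have "W \<subseteq> ?V" using in_V by (auto simp: W_def S_def)
  ultimately have WV: "W = ?V" by blast
  have bij: "bij_betw (\<lambda>(i, j). \<phi> i j) (SIGMA i:{..<g}. {..m i}) ?V"
    using y(1) WV by (simp add: bij_betw_def valid_def m\<phi> W_def S_def)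

  define F where "F = labelled_edges g m \<phi>"
  define E where "E = F \<union> F\<inverse>"
  have F_cycle: "(c i, c (Suc i mod g)) \<in> F" if "i < g" for i
  proof -
    have "Suc i mod g < g" using g3 by simp
    then have "(c i, c (Suc i mod g)) = (\<phi> i 0, \<phi> (Suc i mod g) 0)" using \<phi>0 that by simp
    then show ?thesis unfolding F_def labelled_edges_def using that by blast
  qed
  have F_path: "(\<phi> i j, \<phi> i (Suc j)) \<in> F" if "i < g" "j < m i" for i j
    unfolding F_def labelled_edges_def using that by blast
  have "F \<subseteq> parcs G"
  proof (rule subrelI)
    fix a b assume "(a, b) \<in> F"
    then consider i j where "i < g" "j < m i" "a = \<phi> i j" "b = \<phi> i (Suc j)"
      | i where "i < g" "a = \<phi> i 0" "b = \<phi> (Suc i mod g) 0"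
      by (auto simp: F_def labelled_edges_def)
    then show "(a, b) \<in> parcs G"
    proof cases
      case 1 then show ?thesis using \<phi>_arc by simp
    next
      case 2
      moreover have "Suc i mod g < g" using g3 by simp
      ultimately show ?thesis using c_arc \<phi>0 by simp
    qed
  qed
  then have EG: "E \<subseteq> parcs G" using arcs_symmetric by (auto simp: E_def)
  have reach_c: "(c 0, c i) \<in> E\<^sup>*" if "i < g" for i
    using that
  proof (induction i)
    case (Suc i)
    then have "(c i, c (Suc i)) \<in> E" using F_cycle[of i] by (simp add: E_def)
    with Suc show ?case by (simp add: rtrancl.rtrancl_into_rtrancl)
  qed simp
  have reach_\<phi>: "(c 0, \<phi> i j) \<in> E\<^sup>*" if "i < g" "j \<le> m i" for i j
    using that
  proof (induction j)
    case 0 then show ?case using reach_c \<phi>0 by simp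
  next
    case (Suc j)
    then have "(\<phi> i j, \<phi> i (Suc j)) \<in> E" using F_path[of i j] by (simp add: E_def)
    with Suc show ?case by (simp add: rtrancl.rtrancl_into_rtrancl)
  qed
  have "sym (E\<^sup>*)" by (intro sym_rtrancl) (auto simp: E_def sym_def)
  have reach_E: "(a, b) \<in> E\<^sup>*" if "a \<in> ?V" "b \<in> ?V" for a b
  proof -
    have "(c 0, a) \<in> E\<^sup>*" "(c 0, b) \<in> E\<^sup>*"
      using that reach_\<phi> unfolding WV[symmetric] W_def S_def by auto
    with \<open>sym (E\<^sup>*)\<close> show ?thesis by (meson rtrancl_trans symE)
  qed
  \<comment> \<open>The cycle through an unlabelled edge must have the edge set \<open>C\<close>, so
    that edge lies on the labelled cycle after all.\<close>
  have "parcs G \<subseteq> E"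
  proof (rule subrelI, rule ccontr)
    fix a b assume ab: "(a, b) \<in> parcs G" "(a, b) \<notin> E"
    obtain q where q: "cycle q" "3 \<le> length q" "(b, a) \<in> set q"
      using cycle_through_extra_edge[OF EG reach_E ab] ab(1) in_arcsD1 in_arcsD2 by blast
    have "(\<lambda>(u, v). {u, v}) ` set q \<in> graph_cycles G" using q by (auto simp: graph_cycles_def)
    from uniq[OF this C] q(3) have "{b, a} \<in> C" by force
    then obtain i where "i < g" "{b, a} = {c i, c (Suc i mod g)}"
      by (auto simp: C_def set_p)
    with F_cycle[of i] ab(2) show False by (auto simp: E_def doubleton_eq_iff)
  qed
  with EG have "parcs G = E" by blast
  then have "quipu_labelling G g m \<phi>"
    using g3 bij by unfold_locales (auto simp: E_def F_def)
  then show ?thesis by blast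
qed

section \<open>Distances and isomorphisms\<close>

lemma (in pair_graph) graph_dist_le_relpow:
  assumes "(u, v) \<in> parcs G ^^ k" "u \<in> pverts G"
  shows "graph_dist G u v \<le> ereal (real k)"
proof -
  have "\<exists>p. awalk u p v \<and> length p = k"
    using assms(1)
  proof (induction k arbitrary: v)
    case 0
    then show ?case using assms(2) by (intro exI[of _ "[]"]) (simp add: awalk_Nil_iff)
  next
    case (Suc k)
    then obtain w where w: "(u, w) \<in> parcs G ^^ k" "(w, v) \<in> parcs G" by auto
    with Suc.IH obtain p where "awalk u p w" "length p = k" by blast
    moreover have "awalk w [(w, v)] v" using w(2) by (simp add: awalk_simps in_arcsD1 in_arcsD2)
    ultimately show ?case by (intro exI[of _ "p @ [(w, v)]"]) (auto intro: awalk_appendI)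
  qed
  then obtain p where p: "awalk u p v" "length p = k" by blast
  have "awalk_cost (\<lambda>_. 1) p = real (length p)" by (induction p) simp_all
  with min_cost_le_walk_cost[OF p(1), of "\<lambda>_. 1"] p(2) show ?thesis by (simp add: graph_dist_def)
qed

text \<open>A potential that rises by at most 1 along every arc bounds all walks at once, with no
  case analysis of their routes.\<close>

lemma (in pair_graph) lipschitz_le_graph_dist:
  fixes h :: "'a \<Rightarrow> int"
  assumes "\<And>x y. (x, y) \<in> parcs G \<Longrightarrow> h y \<le> h x + 1"
  shows "ereal (of_int (h v - h u)) \<le> graph_dist G u v"
  unfolding graph_dist_def \<mu>_def
proof (rule INF_greatest)
  fix p assume "p \<in> {p. awalk u p v}"
  then have "awalk u p v" by simp
  then have "of_int (h v - h u) \<le> awalk_cost (\<lambda>_. 1) p"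
  proof (induction p arbitrary: u)
    case Nil then show ?case by (simp add: awalk_Nil_iff)
  next
    case (Cons e p)
    then have "e \<in> parcs G" "fst e = u" "awalk (snd e) p v" by (auto simp: awalk_Cons_iff)
    then have "h (snd e) \<le> h u + 1" "of_int (h v - h (snd e)) \<le> awalk_cost (\<lambda>_. 1) p"
      using assms[of "fst e" "snd e"] Cons.IH by auto
    then show ?case by simp
  qed
  then show "ereal (of_int (h v - h u)) \<le> ereal (awalk_cost (\<lambda>_. 1) p)" by simp
qed

lemma graph_dist_le_graph_diameter:
  "u \<in> pverts G \<Longrightarrow> v \<in> pverts G \<Longrightarrow> graph_dist G u v \<le> graph_diameter G"
  unfolding graph_diameter_def by (meson SUP_upper SUP_upper2)

lemma graph_diameter_leI:
  "(\<And>u v. u \<in> pverts G \<Longrightarrow> v \<in> pverts G \<Longrightarrow> graph_dist G u v \<le> B) \<Longrightarrow> graph_diameter G \<le> B"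
  unfolding graph_diameter_def by (intro SUP_least)

lemma sym_relpow: "sym R \<Longrightarrow> (x, y) \<in> R ^^ k \<Longrightarrow> (y, x) \<in> R ^^ k"
proof (induction k arbitrary: y)
  case (Suc k)
  then obtain w where "(x, w) \<in> R ^^ k" "(w, y) \<in> R" by auto
  with Suc show ?case by (meson relpow_Suc_I2 symE)
qed simp

lemma digraph_iso_with_proj:
  fixes G :: "'a pair_pre_digraph" and H :: "'b pair_pre_digraph"
  assumes "pair_wf_digraph H" "bij_betw \<psi> (pverts H) (pverts G)"
    and "parcs G = map_prod \<psi> \<psi> ` parcs H"
  shows "digraph_iso (with_proj H) (with_proj G)"
proof -
  interpret H: pair_wf_digraph H by fact
  define hom :: "('b, 'b \<times> 'b, 'a, 'a \<times> 'a) digraph_isomorphism"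
    where "hom = \<lparr>iso_verts = \<psi>, iso_arcs = map_prod \<psi> \<psi>, iso_head = snd, iso_tail = fst\<rparr>"
  have inj: "inj_on \<psi> (pverts H)" using assms(2) by (simp add: bij_betw_def)
  have "inj_on (map_prod \<psi> \<psi>) (parcs H)"
    using map_prod_inj_on[OF inj inj] H.wellformed' by (rule_tac inj_on_subset) auto
  then have "pre_digraph.digraph_isomorphism (with_proj H) hom"
    unfolding pre_digraph.digraph_isomorphism_def
    using inj H.wf_digraph by (auto simp: hom_def)
  moreover have "with_proj G = app_iso hom (with_proj H)"
    using assms by (simp add: app_iso_def hom_def with_proj_def bij_betw_def)
  ultimately show ?thesis unfolding digraph_iso_def by blast
qed

lemma pair_wf_digraph_quipu_one: "pair_wf_digraph (quipu_one k m)"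
  by unfold_locales (auto simp: quipu_one_def Let_def)

context quipu_labelling
begin

section \<open>Coordinates of vertices and arcs\<close>

lemma label_eq_iff:
  assumes "i < g" "j \<le> m i" "k < g" "l \<le> m k"
  shows "\<phi> i j = \<phi> k l \<longleftrightarrow> i = k \<and> j = l"
proof -
  have "inj_on (\<lambda>(i, j). \<phi> i j) (SIGMA i:{..<g}. {..m i})" using bij by (simp add: bij_betw_def)
  from inj_on_eq_iff[OF this, of "(i, j)" "(k, l)"] assms show ?thesis by simp
qed

lemma label_in_verts: "i < g \<Longrightarrow> j \<le> m i \<Longrightarrow> \<phi> i j \<in> pverts G"
  using bij_betw_imp_surj_on[OF bij] by force

lemma label_obtain:
  assumes "v \<in> pverts G" obtains i j where "i < g" "j \<le> m i" "v = \<phi> i j"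
  using assms bij_betw_imp_surj_on[OF bij] by force

lemma card_verts: "card (pverts G) = g + (\<Sum>i<g. m i)"
proof -
  have "card (pverts G) = card (SIGMA i:{..<g}. {..m i})" using bij_betw_same_card[OF bij] by simp
  also have "\<dots> = (\<Sum>i<g. m i + 1)" by simp
  finally show ?thesis by (simp only: sum.distrib) simp
qed

lemma path_arc: "i < g \<Longrightarrow> j < m i \<Longrightarrow> (\<phi> i j, \<phi> i (Suc j)) \<in> parcs G"
  unfolding arcs_eq labelled_edges_def by blast

lemma cycle_arc: "i < g \<Longrightarrow> (\<phi> i 0, \<phi> (Suc i mod g) 0) \<in> parcs G"
  unfolding arcs_eq labelled_edges_def by blast

lemma mod_less_g: "i mod g < g"
  using cycle_length by simp

text \<open>Each pendant path is first eliminated by its ratio bound, which replaces its first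
  vertex by a multiple of the value at the root; what is left is the cyclic inequality.\<close>

lemma prod_bound_of_spectral_radius:
  assumes conn: "Digraph_Component.connected (with_proj G)"
    and rho: "graph_spectral_radius G < 3 / 2 * sqrt 2"
  shows "pendant_lengths g m"
proof -
  obtain \<mu> f where mu: "\<mu> \<le> graph_spectral_radius G" and pos: "\<And>v. v \<in> pverts G \<Longrightarrow> f v > 0"
    and eig: "\<And>v. v \<in> pverts G \<Longrightarrow> (\<Sum>w | w \<in> pverts G \<and> (v, w) \<in> parcs G. f w) = \<mu> * f v"
    using positive_eigenfunction_exists[OF conn] by blast
  have "3 / 2 * sqrt 2 = 3 / sqrt (2::real)" by (simp add: field_simps)
  then have mu3: "\<mu> < 3 / sqrt 2" using mu rho by simp
  \<comment> \<open>Positivity of \<open>f\<close> allows any set of known neighbours in place of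
    the full neighbourhood, so exact neighbourhoods are never computed.\<close>
  have super: "(\<Sum>w\<in>N. f w) < 3 / sqrt 2 * f v"
    if v: "v \<in> pverts G" and N: "\<And>w. w \<in> N \<Longrightarrow> (v, w) \<in> parcs G" for v N
  proof -
    have "(\<Sum>w\<in>N. f w) \<le> (\<Sum>w | w \<in> pverts G \<and> (v, w) \<in> parcs G. f w)"
      using N in_arcsD2 pos pair_finite_verts by (intro sum_mono2) (auto intro: less_imp_le)
    also have "\<dots> = \<mu> * f v" by (rule eig[OF v])
    also have "\<dots> < 3 / sqrt 2 * f v" using mu3 pos[OF v] by (rule mult_strict_right_mono)
    finally show ?thesis .
  qed
  have ratio: "sqrt 2 * (2 ^ m k - 1) * f (\<phi> k 0) < (2 ^ (m k + 1) - 1) * f (\<phi> k 1)"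
    if k: "k < g" "m k \<ge> 1" for k
  proof (rule pendant_path_ratio[of _ "\<lambda>j. f (\<phi> k j)"])
    show "f (\<phi> k j) > 0" if "j \<le> m k" for j using label_in_verts[OF k(1) that] by (rule pos)
    show "f (\<phi> k j) + f (\<phi> k (Suc (Suc j))) < 3 / sqrt 2 * f (\<phi> k (Suc j))" if j: "Suc j < m k" for j
    proof -
      have "(\<Sum>w\<in>{\<phi> k j, \<phi> k (Suc (Suc j))}. f w) < 3 / sqrt 2 * f (\<phi> k (Suc j))"
        using k j path_arc[of k "Suc j"] arcs_symmetric[OF path_arc[of k j]]
        by (intro super label_in_verts) auto
      moreover have "\<phi> k j \<noteq> \<phi> k (Suc (Suc j))" using k j by (subst label_eq_iff) auto
      ultimately show ?thesis by simp
    qed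
    have "(\<Sum>w\<in>{\<phi> k (m k - 1)}. f w) < 3 / sqrt 2 * f (\<phi> k (m k))"
      using k arcs_symmetric[OF path_arc[of k "m k - 1"]] by (intro super label_in_verts) auto
    then show "f (\<phi> k (m k - 1)) < 3 / sqrt 2 * f (\<phi> k (m k))" by simp
  qed (use k in simp)
  define x where "x i = f (\<phi> (i mod g) 0)" for i
  have "(\<Prod>i<g. (2 ^ (m (i mod g) + 2) - 3)\<^sup>2) < (2::real) ^ g"
  proof (rule cyclic_ratio_product_bound[where x = x])
    show "x i > 0" for i unfolding x_def by (intro pos label_in_verts) (use cycle_length in auto)
    fix i
    define k where "k = Suc i mod g"
    define q where "q = i mod g"
    define s where "s = Suc (Suc i) mod g"
    have lt: "k < g" "q < g" "s < g" using mod_less_g by (auto simp: k_def q_def s_def)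
    have qk: "Suc q mod g = k" and ks: "Suc k mod g = s" by (simp_all add: q_def k_def s_def mod_Suc_eq)
    have qs: "q \<noteq> s" using mod_neq_Suc_Suc_mod[OF cycle_length] by (simp add: q_def s_def)
    have neq: "\<phi> q 0 \<noteq> \<phi> s 0" using qs lt by (simp add: label_eq_iff)
    have nb: "(\<phi> k 0, \<phi> q 0) \<in> parcs G" "(\<phi> k 0, \<phi> s 0) \<in> parcs G"
      using cycle_arc[OF lt(1)] arcs_symmetric[OF cycle_arc[OF lt(2)]] by (simp_all add: qk ks)
    have "x i + x (Suc (Suc i)) + sqrt 2 * (2 ^ m k - 1) / (2 ^ (m k + 1) - 1) * f (\<phi> k 0) < 3 / sqrt 2 * f (\<phi> k 0)"
    proof (cases "m k = 0")
      case True
      have "(\<Sum>w\<in>{\<phi> q 0, \<phi> s 0}. f w) < 3 / sqrt 2 * f (\<phi> k 0)"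
        using nb lt by (intro super label_in_verts) auto
      then show ?thesis using True neq by (simp add: x_def q_def s_def)
    next
      case False
      then have mk: "m k \<ge> 1" by simp
      have "(\<Sum>w\<in>{\<phi> q 0, \<phi> s 0, \<phi> k 1}. f w) < 3 / sqrt 2 * f (\<phi> k 0)"
        using nb lt mk path_arc[of k 0] by (intro super label_in_verts) auto
      moreover have "\<phi> q 0 \<noteq> \<phi> k 1" "\<phi> s 0 \<noteq> \<phi> k 1" using lt mk by (simp_all add: label_eq_iff)
      ultimately have 1: "x i + x (Suc (Suc i)) + f (\<phi> k 1) < 3 / sqrt 2 * f (\<phi> k 0)"
        using neq by (simp add: x_def q_def s_def)
      have "(2::real) ^ (m k + 1) - 1 > 0" using one_less_power[of "2::real" "m k + 1"] by simp
      moreover have "N / D * a < b" if "N * a < D * b" "D > 0" for N D a b :: real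
        using that by (simp add: field_simps)
      ultimately have "sqrt 2 * (2 ^ m k - 1) / (2 ^ (m k + 1) - 1) * f (\<phi> k 0) < f (\<phi> k 1)"
        using ratio[OF lt(1) mk] by blast
      with 1 show ?thesis by linarith
    qed
    then show "x i + x (Suc (Suc i)) + sqrt 2 * (2 ^ m (Suc i mod g) - 1)
        / (2 ^ (m (Suc i mod g) + 1) - 1) * x (Suc i) < 3 / sqrt 2 * x (Suc i)"
      by (simp only: x_def k_def)
  qed (use cycle_length in \<open>auto simp: x_def\<close>)
  also have "(\<Prod>i<g. ((2::real) ^ (m (i mod g) + 2) - 3)\<^sup>2) = (\<Prod>i<g. real ((2 ^ (m i + 2) - 3)\<^sup>2))"
  proof (rule prod.cong)
    fix i assume "i \<in> {..<g}"
    moreover have "(3::nat) \<le> 2 ^ (m i + 2)"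
      using power_increasing[of 2 "m i + 2" "2::nat"] by (rule order_trans[rotated]) simp_all
    then have "real (2 ^ (m i + 2) - 3) = 2 ^ (m i + 2) - 3" by (subst of_nat_diff) simp_all
    ultimately show "((2::real) ^ (m (i mod g) + 2) - 3)\<^sup>2 = real ((2 ^ (m i + 2) - 3)\<^sup>2)"
      by (simp only: of_nat_power lessThan_iff mod_less)
  qed simp
  also have "\<dots> = real (\<Prod>i<g. (2 ^ (m i + 2) - 3)\<^sup>2)" by simp
  also have "(2::real) ^ g = real (2 ^ g)" by simp
  finally show ?thesis unfolding of_nat_less_iff by unfold_locales
qed

section \<open>Distances in terms of the labelling\<close>

lemma sym_parcs: "sym (parcs G)"
  using arcs_symmetric by (auto simp: sym_def)

lemma cycle_relpow: "(\<phi> (i mod g) 0, \<phi> ((i + k) mod g) 0) \<in> parcs G ^^ k"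
proof (induction k)
  case (Suc k)
  moreover have "Suc ((i + k) mod g) mod g = (i + Suc k) mod g" by (simp add: mod_Suc_eq)
  ultimately show ?case using cycle_arc[OF mod_less_g, of "i + k"] by auto
qed simp

lemma path_relpow: "i < g \<Longrightarrow> j + d \<le> m i \<Longrightarrow> (\<phi> i j, \<phi> i (j + d)) \<in> parcs G ^^ d"
proof (induction d)
  case (Suc d)
  then show ?case using path_arc[of i "j + d"] by auto
qed simp

text \<open>The two ways around have lengths \<open>k - i\<close> and \<open>g - (k - i)\<close>, so
  the shorter one is at most \<open>g div 2\<close>.\<close>

lemma cycle_within_half:
  assumes "i < g" "k < g"
  shows "\<exists>l \<le> g div 2. (\<phi> i 0, \<phi> k 0) \<in> parcs G ^^ l"
  using assms
proof (induction i k rule: linorder_wlog)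
  case (le i k)
  have 1: "(\<phi> i 0, \<phi> k 0) \<in> parcs G ^^ (k - i)"
    using cycle_relpow[of i "k - i"] le by simp
  have "k + (g - (k - i)) = i + g" using le by simp
  then have "(\<phi> k 0, \<phi> i 0) \<in> parcs G ^^ (g - (k - i))"
    using cycle_relpow[of k "g - (k - i)"] le by simp
  then have 2: "(\<phi> i 0, \<phi> k 0) \<in> parcs G ^^ (g - (k - i))" by (rule sym_relpow[OF sym_parcs])
  show ?case
  proof (cases "k - i \<le> g div 2")
    case False
    then have "g - (k - i) \<le> g div 2" by linarith
    with 2 show ?thesis by blast
  qed (use 1 in blast)
next
  case (sym i k)
  then show ?case using sym_relpow[OF sym_parcs] by blast
qed

text \<open>Within one pendant path the distance is at most \<open>m i\<close>, so an arbitrary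
  second index can be supplied; the indices are thus always distinct, as the arithmetic of pairs
  requires.\<close>

lemma dist_bound:
  assumes "u \<in> pverts G" "v \<in> pverts G"
  shows "\<exists>i<g. \<exists>k<g. i \<noteq> k \<and> graph_dist G u v \<le> ereal (real (m i + m k + g div 2))"
proof -
  obtain i j where u: "i < g" "j \<le> m i" "u = \<phi> i j" using label_obtain[OF assms(1)] .
  obtain k l where v: "k < g" "l \<le> m k" "v = \<phi> k l" using label_obtain[OF assms(2)] .
  have dist: "graph_dist G u v \<le> ereal (real B)" if "(u, v) \<in> parcs G ^^ b" "b \<le> B" for b B
    using graph_dist_le_relpow[OF that(1) assms(1)] that(2) by (auto intro: order_trans)
  show ?thesis
  proof (cases "i = k")
    case True
    have "\<exists>b \<le> m i. (u, v) \<in> parcs G ^^ b"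
    proof (cases "j \<le> l")
      case le: True
      with True u v path_relpow[of i j "l - j"] show ?thesis by (intro exI[of _ "l - j"]) simp
    next
      case False
      with True u v path_relpow[of i l "j - l"] sym_relpow[OF sym_parcs] show ?thesis
        by (intro exI[of _ "j - l"]) simp
    qed
    then obtain b where b: "b \<le> m i" "(u, v) \<in> parcs G ^^ b" by blast
    define k' where "k' = (if i = 0 then 1 else 0::nat)"
    have "k' < g" "i \<noteq> k'" using cycle_length by (auto simp: k'_def)
    then show ?thesis using u(1) dist[OF b(2), of "m i + m k' + g div 2"] b(1) by fastforce
  next
    case False
    obtain b where b: "b \<le> g div 2" "(\<phi> i 0, \<phi> k 0) \<in> parcs G ^^ b"
      using cycle_within_half[OF u(1) v(1)] by blast
    have "(u, \<phi> i 0) \<in> parcs G ^^ j" "(\<phi> k 0, v) \<in> parcs G ^^ l"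
      using path_relpow[of i 0 j] path_relpow[of k 0 l] u v sym_relpow[OF sym_parcs] by auto
    with b(2) have "(u, v) \<in> parcs G ^^ (j + b + l)" unfolding relpow_add by blast
    then show ?thesis using False u v b(1) dist[of "j + b + l" "m i + m k + g div 2"] by fastforce
  qed
qed

text \<open>
  The signed distance \<open>h\<close> from the root of the \<open>i\<close>-th pendant path, negative on that path, is
  1-Lipschitz and separates the end of the path from the opposite vertex of the cycle.
\<close>

lemma diameter_ge:
  assumes i: "i < g"
  shows "ereal (real (m i + g div 2)) \<le> graph_diameter G"
proof -
  define lab where "lab = the_inv_into (SIGMA i:{..<g}. {..m i}) (\<lambda>(i, j). \<phi> i j)"
  have lab: "lab (\<phi> a b) = (a, b)" if "a < g" "b \<le> m a" for a b
    unfolding lab_def using the_inv_into_f_f[of "\<lambda>(i, j). \<phi> i j" "SIGMA i:{..<g}. {..m i}" "(a, b)"] bij that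
    by (simp add: bij_betw_def)
  \<comment> \<open>The number of forward steps from \<open>i\<close> to \<open>a\<close> on the
    cycle; \<open>min (e a) (g - e a)\<close> is then their cyclic distance.\<close>
  define e where "e a = (a + (g - i)) mod g" for a
  define h where "h w = (case lab w of (a, b) \<Rightarrow>
    int (min (e a) (g - e a)) - (if a = i then int b else 0))" for w
  have h: "h (\<phi> a b) = int (min (e a) (g - e a)) - (if a = i then int b else 0)" if "a < g" "b \<le> m a" for a b
    using lab[OF that] by (simp add: h_def)
  have e_lt: "e a < g" for a unfolding e_def by (rule mod_less_g)
  have e_Suc: "e (Suc a mod g) = (if Suc (e a) = g then 0 else Suc (e a))" for a
  proof -
    have "e (Suc a mod g) = Suc (e a) mod g" by (simp add: e_def mod_add_left_eq mod_Suc_eq)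
    then show ?thesis using e_lt[of a] by (simp add: mod_if)
  qed
  have edge: "\<bar>h x - h y\<bar> \<le> 1" if "(x, y) \<in> labelled_edges g m \<phi>" for x y
  proof -
    from that consider a b where "a < g" "b < m a" "x = \<phi> a b" "y = \<phi> a (Suc b)"
      | a where "a < g" "x = \<phi> a 0" "y = \<phi> (Suc a mod g) 0"
      by (auto simp: labelled_edges_def)
    then show ?thesis
    proof cases
      case 1 then show ?thesis by (simp add: h)
    next
      case 2
      then have "h x = int (min (e a) (g - e a))"
        and "h y = int (min (e (Suc a mod g)) (g - e (Suc a mod g)))"
        using mod_less_g by (simp_all add: h)
      then show ?thesis using e_lt[of a] unfolding e_Suc by (auto simp: min_def)
    qed
  qed
  have lip: "h y \<le> h x + 1" if "(x, y) \<in> parcs G" for x y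
    using that edge[of x y] edge[of y x] by (auto simp: arcs_eq)
  define o' where "o' = (i + g div 2) mod g"
  have o': "o' < g" by (simp add: o'_def mod_less_g)
  have "e o' = (i + g div 2 + (g - i)) mod g" by (simp add: e_def o'_def mod_add_left_eq)
  also have "i + g div 2 + (g - i) = g div 2 + g" using i by simp
  finally have eo: "e o' = g div 2" using cycle_length by simp
  have "e i = 0" using i by (simp add: e_def)
  then have "h (\<phi> i (m i)) = - int (m i)" using i by (simp add: h)
  moreover have "h (\<phi> o' 0) = int (g div 2)" using o' by (simp add: h eo)
  ultimately have "ereal (real (m i + g div 2)) \<le> graph_dist G (\<phi> i (m i)) (\<phi> o' 0)"
    using lipschitz_le_graph_dist[of h, OF lip, where v = "\<phi> o' 0" and u = "\<phi> i (m i)"] by (simp add: add.commute)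
  also have "\<dots> \<le> graph_diameter G"
    using i o' by (intro graph_dist_le_graph_diameter label_in_verts) auto
  finally show ?thesis .
qed

lemma iso_quipu_one:
  assumes k: "k < g" and others: "\<And>l. l < g \<Longrightarrow> l \<noteq> k \<Longrightarrow> m l = 0"
  shows "digraph_iso (with_proj G) (with_proj (quipu_one (g - 1) (m k)))"
proof -
  define H where "H = quipu_one (g - 1) (m k)"
  \<comment> \<open>\<open>quipu_one\<close> attaches its path at the last cycle vertex
    \<open>g - 1\<close>, so the cycle is rotated to start just after \<open>k\<close>. Both
    branches of the formula agree at \<open>t = g - 1\<close>, the root.\<close>
  define \<psi> where "\<psi> t = (if t < g then \<phi> ((t + Suc k) mod g) 0 else \<phi> k (t - (g - 1)))" for t
  have \<psi>_cycle: "\<psi> t = \<phi> ((t + Suc k) mod g) 0" if "t < g" for t using that by (simp add: \<psi>_def)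
  have \<psi>_path: "\<psi> (g - 1 + j) = \<phi> k j" for j
  proof (cases j)
    case 0
    have "g - 1 + Suc k = k + g" using cycle_length by simp
    then have "(g - 1 + Suc k) mod g = k" using k by simp
    then show ?thesis using 0 cycle_length by (simp add: \<psi>_def)
  qed (use cycle_length in \<open>simp add: \<psi>_def\<close>)
  have index: "\<exists>t<g. (t + Suc k) mod g = i" if "i < g" for i
  proof -
    have "((i + (g - Suc k)) mod g + Suc k) mod g = (i + (g - Suc k) + Suc k) mod g"
      by (simp only: mod_add_left_eq)
    also have "i + (g - Suc k) + Suc k = i + g" using k by simp
    finally show ?thesis using that mod_less_g by (intro exI[of _ "(i + (g - Suc k)) mod g"]) simp
  qed
  have verts_H: "pverts H = {0..g - 1 + m k}" by (simp add: H_def quipu_one_def Let_def)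
  have "\<psi> ` pverts H = pverts G"
  proof (intro equalityI subsetI)
    fix v assume "v \<in> \<psi> ` pverts H"
    then obtain t where t: "t \<le> g - 1 + m k" "v = \<psi> t" by (auto simp: verts_H)
    show "v \<in> pverts G"
    proof (cases "t < g")
      case True then show ?thesis using t mod_less_g by (simp add: \<psi>_cycle label_in_verts)
    next
      case False
      then show ?thesis using t k by (simp add: \<psi>_def label_in_verts)
    qed
  next
    fix v assume "v \<in> pverts G"
    then obtain i j where v: "i < g" "j \<le> m i" "v = \<phi> i j" by (rule label_obtain)
    show "v \<in> \<psi> ` pverts H"
    proof (cases "i = k")
      case True
      then have "v = \<psi> (g - 1 + j)" using v \<psi>_path by simp
      then show ?thesis using v True by (auto simp: verts_H)
    next
      case False
      then have "j = 0" using others v by simp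
      obtain t where "t < g" "(t + Suc k) mod g = i" using index[OF v(1)] by blast
      then have "v = \<psi> t" "t \<in> pverts H" using v \<open>j = 0\<close> by (auto simp: \<psi>_cycle verts_H)
      then show ?thesis by blast
    qed
  qed
  moreover have "card (pverts H) = card (pverts G)"
  proof -
    have "(\<Sum>i<g. m i) = m k" using k others by (subst sum.remove[of _ k]) auto
    then show ?thesis using cycle_length by (simp add: verts_H card_verts)
  qed
  moreover have "finite (pverts H)" by (simp add: verts_H)
  ultimately have bij: "bij_betw \<psi> (pverts H) (pverts G)"
    by (metis bij_betw_def eq_card_imp_inj_on)
  define F where "F = labelled_edges g m \<phi>"
  define E where "E = {(i, i + 1) | i. i < g - 1 + m k} \<union> {(0, g - 1)}"
  have arcs_H: "parcs H = E \<union> E\<inverse>" by (simp add: H_def quipu_one_def Let_def E_def)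
  have F_cycle: "(\<phi> i 0, \<phi> (Suc i mod g) 0) \<in> F" if "i < g" for i
    unfolding F_def labelled_edges_def using that by blast
  have F_path: "(\<phi> k j, \<phi> k (Suc j)) \<in> F" if "j < m k" for j
    unfolding F_def labelled_edges_def using that k by blast
  have step: "(\<psi> t, \<psi> (Suc t)) \<in> F" if t: "t < g - 1 + m k" for t
  proof (cases "Suc t < g")
    case True
    moreover have "Suc ((t + Suc k) mod g) mod g = (Suc t + Suc k) mod g" by (simp add: mod_Suc_eq)
    ultimately show ?thesis using F_cycle[OF mod_less_g, of "t + Suc k"] by (simp add: \<psi>_cycle)
  next
    case False
    then have "g - 1 \<le> t" by linarith
    then obtain j where j: "t = g - 1 + j" using le_Suc_ex by blast
    then have "j < m k" using t by simp
    then show ?thesis using F_path[of j] \<psi>_path[of j] \<psi>_path[of "Suc j"] j by simp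
  qed
  have close: "\<psi> 0 = \<phi> (Suc k mod g) 0" "\<psi> (g - 1) = \<phi> k 0"
    using \<psi>_cycle[of 0] \<psi>_path[of 0] cycle_length by auto
  have 1: "map_prod \<psi> \<psi> ` E \<subseteq> F \<union> F\<inverse>"
    using step F_cycle[OF k] close by (auto simp: E_def)
  have 2: "F \<subseteq> map_prod \<psi> \<psi> ` (E \<union> E\<inverse>)"
  proof (rule subrelI)
    fix x y assume "(x, y) \<in> F"
    then consider i j where "i < g" "j < m i" "x = \<phi> i j" "y = \<phi> i (Suc j)"
      | i where "i < g" "x = \<phi> i 0" "y = \<phi> (Suc i mod g) 0"
      by (auto simp: F_def labelled_edges_def)
    then show "(x, y) \<in> map_prod \<psi> \<psi> ` (E \<union> E\<inverse>)"
    proof cases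
      case 1
      then have "i = k" using others by (metis not_less_zero)
      then have "(x, y) = map_prod \<psi> \<psi> (g - 1 + j, g - 1 + j + 1)"
        using 1 \<psi>_path[of j] \<psi>_path[of "Suc j"] by simp
      moreover have "(g - 1 + j, g - 1 + j + 1) \<in> E" using 1 \<open>i = k\<close> by (auto simp: E_def)
      ultimately show ?thesis by blast
    next
      case 2
      show ?thesis
      proof (cases "i = k")
        case True
        then have "(x, y) = map_prod \<psi> \<psi> (g - 1, 0)" using 2 close by simp
        moreover have "(g - 1, 0) \<in> E\<inverse>" by (simp add: E_def)
        ultimately show ?thesis by blast
      next
        case False
        obtain t where t: "t < g" "(t + Suc k) mod g = i" using index[OF 2(1)] by blast
        have "t \<noteq> g - 1"
        proof
          assume "t = g - 1"
          then have "t + Suc k = k + g" using cycle_length by simp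
          moreover have "(k + g) mod g = k" using k by simp
          ultimately show False using t False by metis
        qed
        then have t': "Suc t < g" using t by simp
        have "(Suc t + Suc k) mod g = Suc i mod g" using t(2) by (metis add_Suc mod_Suc_eq)
        then have "(x, y) = map_prod \<psi> \<psi> (t, t + 1)" using 2 t t' \<psi>_cycle[OF t'] by (simp add: \<psi>_cycle)
        moreover have "(t, t + 1) \<in> E" using t' by (auto simp: E_def)
        ultimately show ?thesis by blast
      qed
    qed
  qed
  have arcs: "parcs G = map_prod \<psi> \<psi> ` parcs H"
  proof -
    have "map_prod \<psi> \<psi> ` (E\<inverse>) = (map_prod \<psi> \<psi> ` E)\<inverse>" by force
    then have img: "map_prod \<psi> \<psi> ` (E \<union> E\<inverse>) = map_prod \<psi> \<psi> ` E \<union> (map_prod \<psi> \<psi> ` E)\<inverse>"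
      by (simp add: image_Un)
    show ?thesis using 1 2 unfolding arcs_H img arcs_eq F_def[symmetric] by blast
  qed
  have wf: "pair_wf_digraph H" unfolding H_def by (rule pair_wf_digraph_quipu_one)
  then have "wf_digraph (with_proj H)" by (simp only: wf_digraph_wp_iff)
  from digraph_iso_swap[OF this digraph_iso_with_proj[OF wf bij arcs]]
  show ?thesis by (simp only: H_def)
qed

end

theorem theorem1p2:
  fixes L :: "'a pair_pre_digraph" and n :: nat
  assumes "closed_quipu L"
    and "card (pverts L) = n"
    and "n \<ge> 13"
    and "graph_spectral_radius L < 3 / 2 * sqrt 2"
  shows "ereal (real n / 3) < graph_diameter L
    \<and> graph_diameter L \<le> ereal ((2 * real n - 2) / 3)
    \<and> ((\<forall>m::nat. m \<ge> 1 \<longrightarrow>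
           \<not> digraph_iso (with_proj L) (with_proj (quipu_one (2 * m + 3) m)) \<and>
           \<not> digraph_iso (with_proj L) (with_proj (quipu_one (2 * m + 5) m)))
        \<longrightarrow> graph_diameter L \<le> ereal ((2 * real n - 4) / 3))"
proof -
  obtain g m \<phi> where "quipu_labelling L g m \<phi>" using closed_quipu_labelling[OF assms(1)] by blast
  then interpret quipu_labelling L g m \<phi> .
  interpret pendant_lengths g m
    using prod_bound_of_spectral_radius assms by (simp add: closed_quipu_def)
  have n: "n = g + (\<Sum>i<g. m i)" using card_verts assms(2) by simp
  define h where "h = g div 2"
  have h: "g \<le> 2 * h + 1" unfolding h_def by simp
  have lower: "ereal (real n / 3) < graph_diameter L"
  proof (cases "\<exists>i<g. m i \<ge> 1")
    case True
    then obtain i where i: "i < g" "m i \<ge> 1" by blast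
    \<comment> \<open>From \<open>2 * (\<Sum>i<g. m i) < g <= 2 * h + 1\<close> the total pendant
      length is at most \<open>h\<close>, so \<open>n <= 3 * h + 1\<close>; a nonempty pendant
      absorbs the 1.\<close>
    have "n < 3 * m i + 3 * h" using twice_sum_less n i(2) h by linarith
    then have "ereal (real n / 3) < ereal (real (m i + g div 2))"
      unfolding h_def[symmetric] by simp
    also have "\<dots> \<le> graph_diameter L" by (rule diameter_ge[OF i(1)])
    finally show ?thesis .
  next
    case False
    then have "n = g" using n by (simp add: Suc_le_eq)
    then have "n < 3 * h" using assms(3) h by linarith
    then have "ereal (real n / 3) < ereal (real (m 0 + g div 2))"
      unfolding h_def[symmetric] by simp
    also have "\<dots> \<le> graph_diameter L" using cycle_length by (intro diameter_ge) simp
    finally show ?thesis .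
  qed
  \<comment> \<open>The slack \<open>c\<close> is 2 in general and 4 outside the exceptional
    families.\<close>
  have upper: "graph_diameter L \<le> ereal ((2 * real n - real c) / 3)"
    if "\<And>i k. i < g \<Longrightarrow> k < g \<Longrightarrow> i \<noteq> k \<Longrightarrow> 3 * (m i + m k + g div 2) + c \<le> 2 * n" for c
  proof (rule graph_diameter_leI)
    fix u v assume "u \<in> pverts L" "v \<in> pverts L"
    then obtain i k where ik: "i < g" "k < g" "i \<noteq> k"
      and dist: "graph_dist L u v \<le> ereal (real (m i + m k + g div 2))"
      using dist_bound by blast
    note dist
    also have "real (m i + m k + g div 2) \<le> (2 * real n - real c) / 3"
    proof -
      have "real (3 * (m i + m k + g div 2) + c) \<le> real (2 * n)"
        using that[OF ik] by (simp only: of_nat_le_iff)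
      then show ?thesis by simp
    qed
    finally show "graph_dist L u v \<le> ereal ((2 * real n - real c) / 3)" by simp
  qed
  have "graph_diameter L \<le> ereal ((2 * real n - 4) / 3)"
    if noniso: "\<forall>m::nat. m \<ge> 1 \<longrightarrow>
           \<not> digraph_iso (with_proj L) (with_proj (quipu_one (2 * m + 3) m)) \<and>
           \<not> digraph_iso (with_proj L) (with_proj (quipu_one (2 * m + 5) m))"
  proof -
    have "\<not> (\<exists>k<g. m k \<ge> 1 \<and> (\<forall>l<g. l \<noteq> k \<longrightarrow> m l = 0) \<and> (g = 2 * m k + 4 \<or> g = 2 * m k + 6))"
    proof clarify
      fix k assume k: "k < g" "m k \<ge> 1" "\<forall>l<g. l \<noteq> k \<longrightarrow> m l = 0" "g = 2 * m k + 4 \<or> g = 2 * m k + 6"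
      then have "g - 1 = 2 * m k + 3 \<or> g - 1 = 2 * m k + 5" by linarith
      with iso_quipu_one[OF k(1)] k noniso show False by metis
    qed
    then have "3 * (m i + m k + g div 2) + 4 \<le> 2 * n" if "i < g" "k < g" "i \<noteq> k" for i k
      using pair_bound(2)[OF that n assms(3)] by blast
    from upper[OF this] show ?thesis by simp
  qed
  moreover have "graph_diameter L \<le> ereal ((2 * real n - 2) / 3)"
    using upper[OF pair_bound(1)[OF _ _ _ n assms(3)]] by simp
  ultimately show ?thesis using lower by blast
qed

end
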